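(* Let $\mathcal{A}\otimes\mathcal{C}$, $\epsilon$, the elements $O_A$, $O_{A_1,\dots,A_r}$ and the supercommutator $\llbracket\cdot,\cdot\rrbracket_-$ be as defined in the context. Let $A$ and $B$ be two lists of $\{1,\dots,N\}$ such that $A\subset B$ as sets. Then $$\llbracket O_A,O_B\rrbracket_-=\epsilon\sum_{a\in A}\llbracket O_a,O_{a,A,B}\rrbracket_-.$$
   Context: Let $\mathbb{K}$ be $\mathbb{R}$ or $\mathbb{C}$ and $N\ge1$. $\mathcal{A}$ is the unital associative $\mathbb{K}$-algebra generated by $x_1,\dots,x_N,p_1,\dots,p_N$ subject to the relations, for all $i,j$, $$[x_i,x_j]=0,\quad [p_i,p_j]=0,\quad \Big[\tfrac12\sum_{i=1}^N p_i^2,\,x_j\Big]=p_j,\quad \Big[\tfrac12\sum_{i=1}^N x_i^2,\,p_j\Big]=-x_j,$$ where $[a,b]=ab-ba$. Fix $\epsilon\in\{+1,-1\}$. $\mathcal{C}$ is the Clifford algebra over $\mathbb{K}$ generated by $e_1,\dots,e_N$ with $e_ie_j+e_je_i=2\epsilon\delta_{ij}$. In $\mathcal{A}\otimes\mathcal{C}$ the tensor sign is omitted, and the $e_i$ commute with all $x_j,p_j$. Put $\underline{D}=\sum_{i=1}^N e_ip_i$. A list is a finite (possibly empty) sequence $A=a_1\cdots a_n$ of distinct elements of $\{1,\dots,N\}$, $|A|=n$; $e_A=e_{a_1}\cdots e_{a_n}$, $e_\emptyset=1$. In set operations a list is viewed as its underlying set; $A\triangle B=(A\cup B)\setminus(A\cap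 B)$ is the symmetric difference. For a set (or list) $S\subset\{1,\dots,N\}$, $\underline{x}_S=\sum_{s\in S}x_se_s$. For lists $A_1,\dots,A_r$ ($r\ge1$), with $S=A_1\triangle\cdots\triangle A_r$ and $E=e_{A_1}\cdots e_{A_r}$, define $$O_{A_1,\dots,A_r}=\tfrac12\big(\underline{D}\,\underline{x}_S E-E\,\underline{x}_S\underline{D}-\epsilon E\big);$$ in particular $O_A$ is the case $r=1$, and $O_a$ is the case of the one-element list $a$. The set $S$ is called the index set of $O_{A_1,\dots,A_r}$. For two such operators $X,Y$ with index sets $S,T$, the supercommutators are $$\llbracket X,Y\rrbracket_\mp=XY\mp(-1)^{|S||T|-|S\cap T|}YX .$$ *)

theory Defs
  imports
    "HOL-Analysis.Analysis"
    "HOL-Library.Poly_Mapping"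
    "HOL-Algebra.QuotRing"
    "HOL-Algebra.Module"
begin

text \<open>
  Unital associative algebras over \<open>'k\<close> are represented as records of type
  \<^typ>\<open>('k, 'a) module\<close>: a (not necessarily commutative) ring together with a scalar
  multiplication. The ground field of the final statement has class
  \<^class>\<open>real_normed_field\<close>; by the Gelfand-Mazur theorem the instances of this class are,
  up to isomorphism, exactly the real and the complex numbers.
\<close>

section \<open>Free algebras, quotients and tensor products\<close>

definition monoid_algebra :: "('m, 'z) monoid_scheme \<Rightarrow> ('k::comm_ring_1, 'm \<Rightarrow>\<^sub>0 'k) module" where
  "monoid_algebra G =
    \<lparr>carrier = {f. Poly_Mapping.keys f \<subseteq> carrier G},
     mult = (\<lambda>f g. \<Sum>u\<in>Poly_Mapping.keys f. \<Sum>v\<in>Poly_Mapping.keys g.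
       Poly_Mapping.single (u \<otimes>\<^bsub>G\<^esub> v) (Poly_Mapping.lookup f u * Poly_Mapping.lookup g v)),
     one = Poly_Mapping.single \<one>\<^bsub>G\<^esub> 1,
     zero = 0,
     add = (+),
     smult = (\<lambda>c. Poly_Mapping.map ((*) c))\<rparr>"

definition free_monoid :: "'g set \<Rightarrow> 'g list monoid" where
  "free_monoid G = \<lparr>carrier = lists G, mult = (@), one = []\<rparr>"

definition free_algebra :: "'g set \<Rightarrow> ('k::comm_ring_1, 'g list \<Rightarrow>\<^sub>0 'k) module" where
  "free_algebra G = monoid_algebra (free_monoid G)"

definition free_gen :: "'g \<Rightarrow> ('g list \<Rightarrow>\<^sub>0 'k::comm_ring_1)" where
  "free_gen g = Poly_Mapping.single [g] 1"

text \<open>The ring structure is that of \<^term>\<open>M Quot I\<close>, where \<open>I\<close> is a two-sided ideal; the scalar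
  multiplication sends the coset of \<open>f\<close> to the coset of \<open>c \<odot> f\<close>.\<close>

definition quotient_algebra :: "('k, 'a) module \<Rightarrow> 'a set \<Rightarrow> ('k, 'a set) module" where
  "quotient_algebra M I =
    \<lparr>carrier = carrier (M Quot I), mult = mult (M Quot I), one = one (M Quot I),
     zero = zero (M Quot I), add = add (M Quot I),
     smult = (\<lambda>c X. \<Union>f\<in>X. I +>\<^bsub>M\<^esub> (c \<odot>\<^bsub>M\<^esub> f))\<rparr>"

text \<open>The algebra generated by \<open>G\<close> subject to the relations \<open>r = 0\<close> for \<open>r \<in> R\<close>.\<close>

definition presented_algebra ::
    "'g set \<Rightarrow> ('g list \<Rightarrow>\<^sub>0 'k) set \<Rightarrow> ('k::comm_ring_1, ('g list \<Rightarrow>\<^sub>0 'k) set) module" where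
  "presented_algebra G R = quotient_algebra (free_algebra G) (Idl\<^bsub>free_algebra G\<^esub> R)"

definition presented_gen ::
    "'g set \<Rightarrow> ('g list \<Rightarrow>\<^sub>0 'k) set \<Rightarrow> 'g \<Rightarrow> ('g list \<Rightarrow>\<^sub>0 'k::comm_ring_1) set" where
  "presented_gen G R g = (Idl\<^bsub>free_algebra G\<^esub> R) +>\<^bsub>free_algebra G\<^esub> free_gen g"

text \<open>
  The tensor product over \<open>'k\<close> is the free \<open>'k\<close>-module on \<^term>\<open>carrier M \<times> carrier L\<close> modulo
  the bilinearity relations. Multiplying pairs componentwise makes the free module a monoid
  algebra, with product \<open>(a \<otimes> c) (a' \<otimes> c') = a a' \<otimes> c c'\<close>. The span of the relations below is
  stable under multiplication by pairs on either side, so it is the two-sided ideal they generate.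
\<close>

definition pair_algebra ::
    "('k, 'a) module \<Rightarrow> ('k, 'b) module \<Rightarrow> ('k::comm_ring_1, ('a \<times> 'b) \<Rightarrow>\<^sub>0 'k) module" where
  "pair_algebra M L = monoid_algebra (M \<times>\<times> L)"

definition bilinear_relations ::
    "('k, 'a) module \<Rightarrow> ('k, 'b) module \<Rightarrow> (('a \<times> 'b) \<Rightarrow>\<^sub>0 'k::comm_ring_1) set" where
  "bilinear_relations M L =
    {Poly_Mapping.single (a \<oplus>\<^bsub>M\<^esub> a', c) 1
      - Poly_Mapping.single (a, c) 1 - Poly_Mapping.single (a', c) 1 | a a' c.
      a \<in> carrier M \<and> a' \<in> carrier M \<and> c \<in> carrier L}
  \<union> {Poly_Mapping.single (a, c \<oplus>\<^bsub>L\<^esub> c') 1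
      - Poly_Mapping.single (a, c) 1 - Poly_Mapping.single (a, c') 1 | a c c'.
      a \<in> carrier M \<and> c \<in> carrier L \<and> c' \<in> carrier L}
  \<union> {Poly_Mapping.single (k \<odot>\<^bsub>M\<^esub> a, c) 1 - Poly_Mapping.single (a, c) k | k a c.
      a \<in> carrier M \<and> c \<in> carrier L}
  \<union> {Poly_Mapping.single (a, k \<odot>\<^bsub>L\<^esub> c) 1 - Poly_Mapping.single (a, c) k | k a c.
      a \<in> carrier M \<and> c \<in> carrier L}"

definition tensor_algebra ::
    "('k, 'a) module \<Rightarrow> ('k, 'b) module \<Rightarrow> ('k::comm_ring_1, (('a \<times> 'b) \<Rightarrow>\<^sub>0 'k) set) module" where
  "tensor_algebra M L =
    quotient_algebra (pair_algebra M L) (Idl\<^bsub>pair_algebra M L\<^esub> (bilinear_relations M L))"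

definition pure_tensor ::
    "('k, 'a) module \<Rightarrow> ('k, 'b) module \<Rightarrow> 'a \<Rightarrow> 'b \<Rightarrow> (('a \<times> 'b) \<Rightarrow>\<^sub>0 'k::comm_ring_1) set" where
  "pure_tensor M L a c =
    (Idl\<^bsub>pair_algebra M L\<^esub> (bilinear_relations M L)) +>\<^bsub>pair_algebra M L\<^esub> Poly_Mapping.single (a, c) 1"

definition commutator :: "('a, 'z) ring_scheme \<Rightarrow> 'a \<Rightarrow> 'a \<Rightarrow> 'a" where
  "commutator M a b = (a \<otimes>\<^bsub>M\<^esub> b) \<ominus>\<^bsub>M\<^esub> (b \<otimes>\<^bsub>M\<^esub> a)"


section \<open>The algebra generated by \<open>x\<close> and \<open>p\<close>, and the Clifford algebra\<close>

datatype xp = X nat | P nat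

definition xp_gens :: "nat \<Rightarrow> xp set" where
  "xp_gens N = X ` {1..N} \<union> P ` {1..N}"

definition xp_relations :: "nat \<Rightarrow> (xp list \<Rightarrow>\<^sub>0 'k::field) set" where
  "xp_relations N = (let F = free_algebra (xp_gens N);
      x = (\<lambda>i. free_gen (X i)); p = (\<lambda>i. free_gen (P i)) in
    {commutator F (x i) (x j) | i j. i \<in> {1..N} \<and> j \<in> {1..N}}
  \<union> {commutator F (p i) (p j) | i j. i \<in> {1..N} \<and> j \<in> {1..N}}
  \<union> {commutator F ((1/2) \<odot>\<^bsub>F\<^esub> (\<Oplus>\<^bsub>F\<^esub>i\<in>{1..N}. p i \<otimes>\<^bsub>F\<^esub> p i)) (x j) \<ominus>\<^bsub>F\<^esub> p j | j. j \<in> {1..N}}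
  \<union> {commutator F ((1/2) \<odot>\<^bsub>F\<^esub> (\<Oplus>\<^bsub>F\<^esub>i\<in>{1..N}. x i \<otimes>\<^bsub>F\<^esub> x i)) (p j) \<oplus>\<^bsub>F\<^esub> x j | j. j \<in> {1..N}})"

definition xp_algebra :: "nat \<Rightarrow> ('k::field, (xp list \<Rightarrow>\<^sub>0 'k) set) module" where
  "xp_algebra N = presented_algebra (xp_gens N) (xp_relations N)"

definition clifford_relations :: "nat \<Rightarrow> 'k \<Rightarrow> (nat list \<Rightarrow>\<^sub>0 'k::field) set" where
  "clifford_relations N \<epsilon> = (let F = free_algebra {1..N}; e = free_gen in
    {(e i \<otimes>\<^bsub>F\<^esub> e j \<oplus>\<^bsub>F\<^esub> e j \<otimes>\<^bsub>F\<^esub> e i) \<ominus>\<^bsub>F\<^esub> ((2 * \<epsilon> * (if i = j then 1 else 0)) \<odot>\<^bsub>F\<^esub> \<one>\<^bsub>F\<^esub>) | i j.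
      i \<in> {1..N} \<and> j \<in> {1..N}})"

definition clifford_algebra :: "nat \<Rightarrow> 'k \<Rightarrow> ('k::field, (nat list \<Rightarrow>\<^sub>0 'k) set) module" where
  "clifford_algebra N \<epsilon> = presented_algebra {1..N} (clifford_relations N \<epsilon>)"

type_synonym 'k AC = "(((xp list \<Rightarrow>\<^sub>0 'k) set \<times> (nat list \<Rightarrow>\<^sub>0 'k) set) \<Rightarrow>\<^sub>0 'k) set"

definition AC :: "nat \<Rightarrow> 'k \<Rightarrow> ('k::field, 'k AC) module" where
  "AC N \<epsilon> = tensor_algebra (xp_algebra N) (clifford_algebra N \<epsilon>)"

definition x_el :: "nat \<Rightarrow> 'k \<Rightarrow> nat \<Rightarrow> 'k::field AC" where
  "x_el N \<epsilon> i = pure_tensor (xp_algebra N) (clifford_algebra N \<epsilon>)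
     (presented_gen (xp_gens N) (xp_relations N) (X i)) \<one>\<^bsub>clifford_algebra N \<epsilon>\<^esub>"

definition p_el :: "nat \<Rightarrow> 'k \<Rightarrow> nat \<Rightarrow> 'k::field AC" where
  "p_el N \<epsilon> i = pure_tensor (xp_algebra N) (clifford_algebra N \<epsilon>)
     (presented_gen (xp_gens N) (xp_relations N) (P i)) \<one>\<^bsub>clifford_algebra N \<epsilon>\<^esub>"

definition e_el :: "nat \<Rightarrow> 'k \<Rightarrow> nat \<Rightarrow> 'k::field AC" where
  "e_el N \<epsilon> i = pure_tensor (xp_algebra N) (clifford_algebra N \<epsilon>)
     \<one>\<^bsub>xp_algebra N\<^esub> (presented_gen {1..N} (clifford_relations N \<epsilon>) i)"


section \<open>The operators and the supercommutator\<close>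

definition D_el :: "nat \<Rightarrow> 'k \<Rightarrow> 'k::field AC" where
  "D_el N \<epsilon> = (\<Oplus>\<^bsub>AC N \<epsilon>\<^esub>i\<in>{1..N}. e_el N \<epsilon> i \<otimes>\<^bsub>AC N \<epsilon>\<^esub> p_el N \<epsilon> i)"

definition x_vec :: "nat \<Rightarrow> 'k \<Rightarrow> nat set \<Rightarrow> 'k::field AC" where
  "x_vec N \<epsilon> S = (\<Oplus>\<^bsub>AC N \<epsilon>\<^esub>s\<in>S. x_el N \<epsilon> s \<otimes>\<^bsub>AC N \<epsilon>\<^esub> e_el N \<epsilon> s)"

definition alg_prod_list :: "('a, 'z) monoid_scheme \<Rightarrow> 'a list \<Rightarrow> 'a" where
  "alg_prod_list M as = foldr (mult M) as \<one>\<^bsub>M\<^esub>"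

definition e_list :: "nat \<Rightarrow> 'k \<Rightarrow> nat list \<Rightarrow> 'k::field AC" where
  "e_list N \<epsilon> A = alg_prod_list (AC N \<epsilon>) (map (e_el N \<epsilon>) A)"

definition index_set :: "nat list list \<Rightarrow> nat set" where
  "index_set As = foldr (\<lambda>A S. (set A \<union> S) - (set A \<inter> S)) As {}"

text \<open>\<open>O_el N \<epsilon> [A\<^sub>1, \<dots>, A\<^sub>r]\<close> is the element with subscript \<open>A\<^sub>1, \<dots>, A\<^sub>r\<close>.\<close>

definition O_el :: "nat \<Rightarrow> 'k \<Rightarrow> nat list list \<Rightarrow> 'k::field AC" where
  "O_el N \<epsilon> As = (let M = AC N \<epsilon>; D = D_el N \<epsilon>; xS = x_vec N \<epsilon> (index_set As);
      E = alg_prod_list M (map (e_list N \<epsilon>) As) in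
    (1/2) \<odot>\<^bsub>M\<^esub> ((D \<otimes>\<^bsub>M\<^esub> xS \<otimes>\<^bsub>M\<^esub> E \<ominus>\<^bsub>M\<^esub> E \<otimes>\<^bsub>M\<^esub> xS \<otimes>\<^bsub>M\<^esub> D) \<ominus>\<^bsub>M\<^esub> \<epsilon> \<odot>\<^bsub>M\<^esub> E))"

text \<open>
  The supercommutator (with sign minus) of the operators with subscripts \<open>As\<close> and \<open>Bs\<close>. It is
  defined on subscripts because the index sets are read off from them rather than from the
  elements. The exponent never truncates, as \<open>card (S \<inter> T) \<le> card S * card T\<close> for finite sets.
\<close>

definition O_supercomm :: "nat \<Rightarrow> 'k \<Rightarrow> nat list list \<Rightarrow> nat list list \<Rightarrow> 'k::field AC" where
  "O_supercomm N \<epsilon> As Bs = (let M = AC N \<epsilon>; S = index_set As; T = index_set Bs in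
    (O_el N \<epsilon> As \<otimes>\<^bsub>M\<^esub> O_el N \<epsilon> Bs)
    \<ominus>\<^bsub>M\<^esub> ((-1) ^ (card S * card T - card (S \<inter> T))) \<odot>\<^bsub>M\<^esub> (O_el N \<epsilon> Bs \<otimes>\<^bsub>M\<^esub> O_el N \<epsilon> As))"


section \<open>These are algebras\<close>

text \<open>The predicate \<^const>\<open>ideal\<close> includes that the ambient structure is a ring, so the following
  facts also show that \<open>Idl\<close> above is never the degenerate intersection over the empty family.\<close>

lemma monoid_algebra_simps [simp]:
  "carrier (monoid_algebra G) = {f. Poly_Mapping.keys f \<subseteq> carrier G}"
  "\<one>\<^bsub>monoid_algebra G\<^esub> = Poly_Mapping.single \<one>\<^bsub>G\<^esub> 1"
  "\<zero>\<^bsub>monoid_algebra G\<^esub> = 0"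
  "f \<oplus>\<^bsub>monoid_algebra G\<^esub> g = f + g"
  by (simp_all add: monoid_algebra_def)

lemma monoid_algebra_mult_superset:
  assumes "finite U" "Poly_Mapping.keys f \<subseteq> U" "finite V" "Poly_Mapping.keys g \<subseteq> V"
  shows "f \<otimes>\<^bsub>monoid_algebra G\<^esub> g = (\<Sum>u\<in>U. \<Sum>v\<in>V.
    Poly_Mapping.single (u \<otimes>\<^bsub>G\<^esub> v) (Poly_Mapping.lookup f u * Poly_Mapping.lookup g v))"
proof -
  have "f \<otimes>\<^bsub>monoid_algebra G\<^esub> g = (\<Sum>u\<in>Poly_Mapping.keys f. \<Sum>v\<in>V.
    Poly_Mapping.single (u \<otimes>\<^bsub>G\<^esub> v) (Poly_Mapping.lookup f u * Poly_Mapping.lookup g v))"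
    unfolding monoid_algebra_def monoid.simps using assms
    by (intro sum.cong refl sum.mono_neutral_left) (auto simp: in_keys_iff)
  also have "\<dots> = (\<Sum>u\<in>U. \<Sum>v\<in>V.
    Poly_Mapping.single (u \<otimes>\<^bsub>G\<^esub> v) (Poly_Mapping.lookup f u * Poly_Mapping.lookup g v))"
    using assms by (intro sum.mono_neutral_left) (auto simp: in_keys_iff)
  finally show ?thesis .
qed

lemma monoid_algebra_mult_single:
  "Poly_Mapping.single u a \<otimes>\<^bsub>monoid_algebra G\<^esub> Poly_Mapping.single v b =
    Poly_Mapping.single (u \<otimes>\<^bsub>G\<^esub> v) (a * b)"
  by (subst monoid_algebra_mult_superset[where U = "{u}" and V = "{v}"]) auto

lemma monoid_algebra_distl:
  "(f + g) \<otimes>\<^bsub>monoid_algebra G\<^esub> h = f \<otimes>\<^bsub>monoid_algebra G\<^esub> h + g \<otimes>\<^bsub>monoid_algebra G\<^esub> h"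
proof -
  let ?U = "Poly_Mapping.keys f \<union> Poly_Mapping.keys g" and ?V = "Poly_Mapping.keys h"
  have "Poly_Mapping.keys (f + g) \<subseteq> ?U" by (rule Poly_Mapping.keys_add)
  then show ?thesis
    by (simp add: monoid_algebra_mult_superset[where U = ?U and V = ?V] lookup_add
        distrib_right single_add sum.distrib)
qed

lemma monoid_algebra_distr:
  "h \<otimes>\<^bsub>monoid_algebra G\<^esub> (f + g) = h \<otimes>\<^bsub>monoid_algebra G\<^esub> f + h \<otimes>\<^bsub>monoid_algebra G\<^esub> g"
proof -
  let ?V = "Poly_Mapping.keys f \<union> Poly_Mapping.keys g" and ?U = "Poly_Mapping.keys h"
  have "Poly_Mapping.keys (f + g) \<subseteq> ?V" by (rule Poly_Mapping.keys_add)
  then show ?thesis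
    by (simp add: monoid_algebra_mult_superset[where U = ?U and V = ?V] lookup_add
        distrib_left single_add sum.distrib)
qed

lemma monoid_algebra_mult_zero:
  "0 \<otimes>\<^bsub>monoid_algebra G\<^esub> f = 0" "f \<otimes>\<^bsub>monoid_algebra G\<^esub> 0 = 0"
  by (simp_all add: monoid_algebra_def)

lemma monoid_algebra_sum_l:
  "(\<Sum>i\<in>I. f i) \<otimes>\<^bsub>monoid_algebra G\<^esub> h = (\<Sum>i\<in>I. f i \<otimes>\<^bsub>monoid_algebra G\<^esub> h)"
  by (induction I rule: infinite_finite_induct)
    (simp_all add: monoid_algebra_mult_zero monoid_algebra_distl)

lemma monoid_algebra_sum_r:
  "h \<otimes>\<^bsub>monoid_algebra G\<^esub> (\<Sum>i\<in>I. f i) = (\<Sum>i\<in>I. h \<otimes>\<^bsub>monoid_algebra G\<^esub> f i)"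
  by (induction I rule: infinite_finite_induct)
    (simp_all add: monoid_algebra_mult_zero monoid_algebra_distr)

lemma poly_mapping_eq_sum_single:
  "f = (\<Sum>u\<in>Poly_Mapping.keys f. Poly_Mapping.single u (Poly_Mapping.lookup f u))"
proof (rule poly_mapping_eqI)
  fix k
  have "Poly_Mapping.lookup (\<Sum>u\<in>Poly_Mapping.keys f. Poly_Mapping.single u (Poly_Mapping.lookup f u)) k
      = (\<Sum>u\<in>Poly_Mapping.keys f. if k = u then Poly_Mapping.lookup f u else 0)"
    by (auto simp: lookup_sum lookup_single when_def intro!: sum.cong)
  also have "\<dots> = Poly_Mapping.lookup f k"
    by (simp add: in_keys_iff)
  finally show "Poly_Mapping.lookup f k = Poly_Mapping.lookup
    (\<Sum>u\<in>Poly_Mapping.keys f. Poly_Mapping.single u (Poly_Mapping.lookup f u)) k" by simp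
qed

lemma monoid_algebra_mult_closed:
  assumes "monoid G" "Poly_Mapping.keys f \<subseteq> carrier G" "Poly_Mapping.keys g \<subseteq> carrier G"
  shows "Poly_Mapping.keys (f \<otimes>\<^bsub>monoid_algebra G\<^esub> g) \<subseteq> carrier G"
proof -
  interpret monoid G by fact
  have "Poly_Mapping.keys (\<Sum>u\<in>Poly_Mapping.keys f. \<Sum>v\<in>Poly_Mapping.keys g.
      Poly_Mapping.single (u \<otimes>\<^bsub>G\<^esub> v) (Poly_Mapping.lookup f u * Poly_Mapping.lookup g v)) \<subseteq>
    (\<Union>u\<in>Poly_Mapping.keys f. \<Union>v\<in>Poly_Mapping.keys g. {u \<otimes>\<^bsub>G\<^esub> v})"
    by (intro order_trans[OF Poly_Mapping.keys_sum] UN_mono subset_refl) (auto split: if_splits)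
  also have "\<dots> \<subseteq> carrier G"
    using assms by auto
  finally show ?thesis
    by (simp add: monoid_algebra_def)
qed

lemma monoid_algebra_assoc:
  assumes "monoid G" "Poly_Mapping.keys f \<subseteq> carrier G" "Poly_Mapping.keys g \<subseteq> carrier G"
    "Poly_Mapping.keys h \<subseteq> carrier G"
  shows "(f \<otimes>\<^bsub>monoid_algebra G\<^esub> g) \<otimes>\<^bsub>monoid_algebra G\<^esub> h =
    f \<otimes>\<^bsub>monoid_algebra G\<^esub> (g \<otimes>\<^bsub>monoid_algebra G\<^esub> h)"
proof -
  let ?s = "\<lambda>f u. Poly_Mapping.single u (Poly_Mapping.lookup f u)"
  have "(sum (?s f) (Poly_Mapping.keys f) \<otimes>\<^bsub>monoid_algebra G\<^esub> sum (?s g) (Poly_Mapping.keys g))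
        \<otimes>\<^bsub>monoid_algebra G\<^esub> sum (?s h) (Poly_Mapping.keys h) =
    sum (?s f) (Poly_Mapping.keys f) \<otimes>\<^bsub>monoid_algebra G\<^esub>
      (sum (?s g) (Poly_Mapping.keys g) \<otimes>\<^bsub>monoid_algebra G\<^esub> sum (?s h) (Poly_Mapping.keys h))"
    unfolding monoid_algebra_sum_l monoid_algebra_sum_r monoid_algebra_mult_single
    using assms by (intro sum.cong refl) (auto simp: monoid.m_assoc mult.assoc subset_iff)
  then show ?thesis
    by (simp flip: poly_mapping_eq_sum_single)
qed

lemma monoid_algebra_one:
  assumes "monoid G" "Poly_Mapping.keys f \<subseteq> carrier G"
  shows "Poly_Mapping.single \<one>\<^bsub>G\<^esub> 1 \<otimes>\<^bsub>monoid_algebra G\<^esub> f = f"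
    and "f \<otimes>\<^bsub>monoid_algebra G\<^esub> Poly_Mapping.single \<one>\<^bsub>G\<^esub> 1 = f"
proof -
  let ?s = "\<lambda>u. Poly_Mapping.single u (Poly_Mapping.lookup f u)"
  interpret monoid G by fact
  have "Poly_Mapping.single \<one>\<^bsub>G\<^esub> 1 \<otimes>\<^bsub>monoid_algebra G\<^esub> sum ?s (Poly_Mapping.keys f)
      = sum ?s (Poly_Mapping.keys f)"
    unfolding monoid_algebra_sum_r monoid_algebra_mult_single
    using assms by (intro sum.cong refl) (auto simp: subset_iff)
  then show "Poly_Mapping.single \<one>\<^bsub>G\<^esub> 1 \<otimes>\<^bsub>monoid_algebra G\<^esub> f = f"
    by (simp flip: poly_mapping_eq_sum_single)
  have "sum ?s (Poly_Mapping.keys f) \<otimes>\<^bsub>monoid_algebra G\<^esub> Poly_Mapping.single \<one>\<^bsub>G\<^esub> 1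
      = sum ?s (Poly_Mapping.keys f)"
    unfolding monoid_algebra_sum_l monoid_algebra_mult_single
    using assms by (intro sum.cong refl) (auto simp: subset_iff)
  then show "f \<otimes>\<^bsub>monoid_algebra G\<^esub> Poly_Mapping.single \<one>\<^bsub>G\<^esub> 1 = f"
    by (simp flip: poly_mapping_eq_sum_single)
qed

lemma monoid_algebra_ring:
  assumes "monoid G"
  shows "ring (monoid_algebra G :: ('k::comm_ring_1, _) module)"
proof (rule ringI)
  let ?M = "monoid_algebra G :: ('k, _) module"
  interpret monoid G by fact
  have add_closed: "f + g \<in> carrier ?M" if "f \<in> carrier ?M" "g \<in> carrier ?M" for f g
    using that Poly_Mapping.keys_add[of f g] by auto
  have minus_closed: "- f \<in> carrier ?M" if "f \<in> carrier ?M" for f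
    using that by simp
  show "abelian_group ?M"
  proof (rule abelian_groupI)
    show "\<exists>g\<in>carrier ?M. g \<oplus>\<^bsub>?M\<^esub> f = \<zero>\<^bsub>?M\<^esub>" if "f \<in> carrier ?M" for f
      using minus_closed[OF that] by (intro bexI[of _ "- f"]) simp_all
  qed (use add_closed in \<open>simp_all add: add_ac\<close>)
  show "monoid ?M"
  proof (rule monoidI)
    show "f \<otimes>\<^bsub>?M\<^esub> g \<in> carrier ?M" if "f \<in> carrier ?M" "g \<in> carrier ?M" for f g
      using that monoid_algebra_mult_closed[OF assms] by simp
  qed (simp_all add: monoid_algebra_assoc[OF assms] monoid_algebra_one[OF assms])
qed (simp_all add: monoid_algebra_distl monoid_algebra_distr)

lemma free_algebra_ring: "ring (free_algebra G)"
  unfolding free_algebra_def free_monoid_def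
  by (intro monoid_algebra_ring monoidI) auto

lemma quotient_algebra_ring:
  assumes "ideal I M"
  shows "ring (quotient_algebra M I)"
proof -
  interpret Q: ring "M Quot I"
    by (rule ideal.quotient_is_ring[OF assms])
  have eqs: "carrier (quotient_algebra M I) = carrier (M Quot I)"
    "mult (quotient_algebra M I) = mult (M Quot I)"
    "add (quotient_algebra M I) = add (M Quot I)"
    "\<one>\<^bsub>quotient_algebra M I\<^esub> = \<one>\<^bsub>M Quot I\<^esub>"
    "\<zero>\<^bsub>quotient_algebra M I\<^esub> = \<zero>\<^bsub>M Quot I\<^esub>"
    by (simp_all add: quotient_algebra_def)
  show ?thesis
    by (intro ringI abelian_groupI monoidI)
      (auto simp: eqs Q.a_ac Q.m_assoc Q.l_distr Q.r_distr intro: Q.l_neg exI[of _ "\<ominus>\<^bsub>M Quot I\<^esub> _"])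
qed

lemma presented_algebra_ring:
  assumes "R \<subseteq> carrier (free_algebra G)"
  shows "ring (presented_algebra G R)"
  unfolding presented_algebra_def
  by (intro quotient_algebra_ring ring.genideal_ideal free_algebra_ring assms)

lemma free_gen_closed: "g \<in> G \<Longrightarrow> free_gen g \<in> carrier (free_algebra G)"
  by (simp add: free_gen_def free_algebra_def free_monoid_def)

lemma free_algebra_smult_closed:
  "f \<in> carrier (free_algebra G) \<Longrightarrow> c \<odot>\<^bsub>free_algebra G\<^esub> f \<in> carrier (free_algebra G)"
  by (auto simp: free_algebra_def monoid_algebra_def in_keys_iff map.rep_eq when_def subset_iff
      split: if_splits)

lemma xp_gens_closed:
  "i \<in> {1..N} \<Longrightarrow> free_gen (X i) \<in> carrier (free_algebra (xp_gens N))"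
  "i \<in> {1..N} \<Longrightarrow> free_gen (P i) \<in> carrier (free_algebra (xp_gens N))"
  by (intro free_gen_closed; simp add: xp_gens_def)+

lemma xp_relations_closed:
  "xp_relations N \<subseteq> carrier (free_algebra (xp_gens N) :: ('k::field, _) module)"
proof -
  interpret F: ring "free_algebra (xp_gens N) :: ('k, _) module" by (rule free_algebra_ring)
  show ?thesis
    unfolding xp_relations_def Let_def commutator_def
    by (intro Un_least subsetI; elim CollectE exE conjE; hypsubst;
        intro F.minus_closed F.m_closed F.a_closed F.finsum_closed Pi_I xp_gens_closed
          free_algebra_smult_closed; assumption)
qed

lemma clifford_relations_closed:
  "clifford_relations N \<epsilon> \<subseteq> carrier (free_algebra {1..N} :: ('k::field, _) module)"
proof -
  interpret F: ring "free_algebra {1..N} :: ('k, _) module" by (rule free_algebra_ring)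
  show ?thesis
    unfolding clifford_relations_def Let_def
    by (intro subsetI; elim CollectE exE conjE; hypsubst;
        intro F.minus_closed F.m_closed F.a_closed free_gen_closed F.one_closed
          free_algebra_smult_closed; assumption)
qed

lemma xp_algebra_ring: "ring (xp_algebra N)"
  unfolding xp_algebra_def by (intro presented_algebra_ring xp_relations_closed)

lemma clifford_algebra_ring: "ring (clifford_algebra N \<epsilon>)"
  unfolding clifford_algebra_def by (intro presented_algebra_ring clifford_relations_closed)

lemma monoid_algebra_smult:
  assumes "monoid G" "Poly_Mapping.keys f \<subseteq> carrier G"
  shows "c \<odot>\<^bsub>monoid_algebra G\<^esub> f = Poly_Mapping.single \<one>\<^bsub>G\<^esub> c \<otimes>\<^bsub>monoid_algebra G\<^esub> f"
proof -
  interpret monoid G by fact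
  have "Poly_Mapping.single \<one>\<^bsub>G\<^esub> c \<otimes>\<^bsub>monoid_algebra G\<^esub> f =
    (\<Sum>v\<in>Poly_Mapping.keys f. Poly_Mapping.single v (c * Poly_Mapping.lookup f v))"
    using assms
    by (subst monoid_algebra_mult_superset[where U = "{\<one>\<^bsub>G\<^esub>}" and V = "Poly_Mapping.keys f"])
      (auto intro!: sum.cong simp: subset_iff)
  also have "\<dots> = Poly_Mapping.map ((*) c) f"
  proof (rule poly_mapping_eqI)
    fix k
    have "Poly_Mapping.lookup
        (\<Sum>v\<in>Poly_Mapping.keys f. Poly_Mapping.single v (c * Poly_Mapping.lookup f v)) k
      = (\<Sum>v\<in>Poly_Mapping.keys f. if k = v then c * Poly_Mapping.lookup f v else 0)"
      by (auto simp: lookup_sum lookup_single when_def intro!: sum.cong)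
    then show "Poly_Mapping.lookup
        (\<Sum>v\<in>Poly_Mapping.keys f. Poly_Mapping.single v (c * Poly_Mapping.lookup f v)) k
      = Poly_Mapping.lookup (Poly_Mapping.map ((*) c) f) k"
      by (simp add: in_keys_iff map.rep_eq when_def)
  qed
  finally show ?thesis
    by (simp add: monoid_algebra_def)
qed

lemma quotient_monoid_algebra_smult:
  assumes "monoid G" "ideal I (monoid_algebra G)" "Poly_Mapping.keys f \<subseteq> carrier G"
  shows "c \<odot>\<^bsub>quotient_algebra (monoid_algebra G) I\<^esub> (I +>\<^bsub>monoid_algebra G\<^esub> f) =
    I +>\<^bsub>monoid_algebra G\<^esub> (c \<odot>\<^bsub>monoid_algebra G\<^esub> f)"
proof -
  let ?M = "monoid_algebra G"
  interpret monoid G by fact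
  interpret I: ideal I ?M by fact
  have one: "Poly_Mapping.single \<one>\<^bsub>G\<^esub> c \<in> carrier ?M"
    by simp
  have f: "f \<in> carrier ?M"
    using assms(3) by simp
  have smult: "c \<odot>\<^bsub>?M\<^esub> g = Poly_Mapping.single \<one>\<^bsub>G\<^esub> c \<otimes>\<^bsub>?M\<^esub> g" if "g \<in> carrier ?M" for g
    using that assms(1) by (simp add: monoid_algebra_smult)
  have const: "I +>\<^bsub>?M\<^esub> (c \<odot>\<^bsub>?M\<^esub> g) = I +>\<^bsub>?M\<^esub> (c \<odot>\<^bsub>?M\<^esub> f)" if g: "g \<in> I +>\<^bsub>?M\<^esub> f" for g
  proof -
    from g obtain h where h: "h \<in> I" "g = h \<oplus>\<^bsub>?M\<^esub> f"
      unfolding a_r_coset_def' by blast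
    have hc: "h \<in> carrier ?M"
      using h(1) by (rule I.a_Hcarr)
    have "c \<odot>\<^bsub>?M\<^esub> g = Poly_Mapping.single \<one>\<^bsub>G\<^esub> c \<otimes>\<^bsub>?M\<^esub> h \<oplus>\<^bsub>?M\<^esub> c \<odot>\<^bsub>?M\<^esub> f"
      unfolding h(2) smult[OF I.a_closed[OF hc f]] smult[OF f] by (rule I.r_distr[OF hc f one])
    moreover have "Poly_Mapping.single \<one>\<^bsub>G\<^esub> c \<otimes>\<^bsub>?M\<^esub> h \<in> I"
      using h(1) one by (rule I.I_l_closed)
    ultimately have "c \<odot>\<^bsub>?M\<^esub> g \<in> I +>\<^bsub>?M\<^esub> (c \<odot>\<^bsub>?M\<^esub> f)"
      unfolding a_r_coset_def' by blast
    moreover have "c \<odot>\<^bsub>?M\<^esub> f \<in> carrier ?M"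
      unfolding smult[OF f] using one f by (rule I.m_closed)
    ultimately show ?thesis
      by (rule I.a_repr_independence[OF _ _ I.a_subgroup, symmetric])
  qed
  have "f \<in> I +>\<^bsub>?M\<^esub> f"
    using f by (rule I.a_rcos_self)
  then have "(\<Union>g\<in>I +>\<^bsub>?M\<^esub> f. I +>\<^bsub>?M\<^esub> (c \<odot>\<^bsub>?M\<^esub> f)) = I +>\<^bsub>?M\<^esub> (c \<odot>\<^bsub>?M\<^esub> f)"
    by blast
  moreover have "(\<Union>g\<in>I +>\<^bsub>?M\<^esub> f. I +>\<^bsub>?M\<^esub> (c \<odot>\<^bsub>?M\<^esub> g)) = (\<Union>g\<in>I +>\<^bsub>?M\<^esub> f. I +>\<^bsub>?M\<^esub> (c \<odot>\<^bsub>?M\<^esub> f))"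
    by (rule SUP_cong[OF refl const])
  ultimately show ?thesis
    by (simp only: quotient_algebra_def module.simps)
qed

lemma presented_algebra_smult_closed:
  assumes "R \<subseteq> carrier (free_algebra G)" "a \<in> carrier (presented_algebra G R)"
  shows "k \<odot>\<^bsub>presented_algebra G R\<^esub> a \<in> carrier (presented_algebra G R)"
proof -
  let ?F = "monoid_algebra (free_monoid G)" and ?I = "Idl\<^bsub>free_algebra G\<^esub> R"
  have mon: "monoid (free_monoid G)"
    by (rule monoidI) (auto simp: free_monoid_def)
  have I: "ideal ?I ?F"
    using ring.genideal_ideal[OF free_algebra_ring assms(1)] by (simp add: free_algebra_def)
  obtain f where f: "f \<in> carrier ?F" "a = ?I +>\<^bsub>?F\<^esub> f"
    using assms(2)
    by (auto simp: presented_algebra_def quotient_algebra_def FactRing_def A_RCOSETS_def'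
        free_algebra_def)
  have "k \<odot>\<^bsub>?F\<^esub> f \<in> carrier ?F"
    using free_algebra_smult_closed[of f G k] f(1) by (simp add: free_algebra_def)
  then show ?thesis
    using f quotient_monoid_algebra_smult[OF mon I, of f k]
    by (auto simp: presented_algebra_def quotient_algebra_def FactRing_def A_RCOSETS_def'
        free_algebra_def)
qed

lemma keys_diff_subset:
  fixes f g :: "'m \<Rightarrow>\<^sub>0 'k::comm_ring_1"
  assumes "Poly_Mapping.keys f \<subseteq> C" "Poly_Mapping.keys g \<subseteq> C"
  shows "Poly_Mapping.keys (f - g) \<subseteq> C"
proof
  fix u assume "u \<in> Poly_Mapping.keys (f - g)"
  then have "u \<in> Poly_Mapping.keys f \<or> u \<in> Poly_Mapping.keys g"
    unfolding in_keys_iff lookup_minus by fastforce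
  then show "u \<in> C"
    using assms by blast
qed

lemma keys_single_subset: "u \<in> C \<Longrightarrow> Poly_Mapping.keys (Poly_Mapping.single u a) \<subseteq> C"
  by simp

lemma bilinear_relations_closed:
  assumes "ring M" "ring L" "\<And>k a. a \<in> carrier M \<Longrightarrow> k \<odot>\<^bsub>M\<^esub> a \<in> carrier M"
    "\<And>k c. c \<in> carrier L \<Longrightarrow> k \<odot>\<^bsub>L\<^esub> c \<in> carrier L"
  shows "bilinear_relations M L \<subseteq> carrier (pair_algebra M L)"
proof -
  interpret M: ring M by fact
  interpret L: ring L by fact
  show ?thesis
    unfolding bilinear_relations_def pair_algebra_def monoid_algebra_simps carrier_DirProd
    by (intro Un_least subsetI; elim CollectE exE conjE; hypsubst;
        intro CollectI keys_diff_subset keys_single_subset SigmaI M.a_closed L.a_closed assms(3,4);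
        assumption)
qed

lemma pair_algebra_ring:
  assumes "ring M" "ring L"
  shows "ring (pair_algebra M L)"
  unfolding pair_algebra_def
  by (intro monoid_algebra_ring DirProd_monoid ring.is_monoid assms)

lemma AC_ring: "ring (AC N \<epsilon>)"
  unfolding AC_def tensor_algebra_def
  by (intro quotient_algebra_ring ring.genideal_ideal pair_algebra_ring bilinear_relations_closed
      xp_algebra_ring clifford_algebra_ring)
    (simp_all add: xp_algebra_def clifford_algebra_def presented_algebra_smult_closed
      xp_relations_closed clifford_relations_closed del: One_nat_def)

end

theory Submission
  imports Defs
begin

text \<open>
  Let \<open>X = \<Sum> x\<^sub>i e\<^sub>i\<close>, regard the \<open>e\<^sub>i\<close> as odd, and let brackets in this paragraph be supercommutators. Since
  \<open>2 x\<^sub>A e\<^sub>A = [X, e\<^sub>A]\<close>, one has \<open>4 O\<^sub>A = \<Omega>(e\<^sub>A)\<close> with \<open>\<Omega>(w) = [D, [X, w]] - 2 \<epsilon> w\<close>. The operator \<open>O\<^sub>A\<close>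
  supercommutes with \<open>D\<close>, as \<open>[D\<^sup>2, x\<^sub>A] = 2 \<epsilon> p\<^sub>A\<close>, and also with \<open>X\<close>, as it is invariant under \<open>x \<mapsto> p\<close>,
  \<open>p \<mapsto> - x\<close> by the symmetry of \<open>C\<^sub>i\<^sub>j = [p\<^sub>i, x\<^sub>j]\<close>. Hence \<open>4 O\<^sub>A O\<^sub>B = \<Omega>(O\<^sub>A e\<^sub>B)\<close> and \<open>4 O\<^sub>B O\<^sub>A = \<Omega>(e\<^sub>B O\<^sub>A)\<close>, and both
  sides of the claim are \<open>\<Omega>\<close> applied to brackets of an operator with a Clifford monomial. Each of
  these equals a multiple of \<open>\<Sum> C\<^sub>i\<^sub>a e\<^sub>i e\<^sub>a e\<^sub>A e\<^sub>B\<close> over \<open>a \<in> A\<close>, \<open>i \<notin> B\<close>: in the sum of the brackets with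
  \<open>O\<^sub>a\<close> the remaining terms, with \<open>i, a \<in> A\<close>, cancel by the symmetry of \<open>C\<close>.
\<close>

section \<open>Computations with \<open>x\<close>, \<open>p\<close> and \<open>e\<close> in a ring\<close>

text \<open>The sign (-1)^n as an operation on an additive group, since the rings below need not
  have a unit from which -1 could be formed.\<close>

definition alt :: "nat \<Rightarrow> 'a::ab_group_add \<Rightarrow> 'a" where
  "alt n y = (if even n then y else - y)"

lemma alt_alt: "alt m (alt n y) = alt (m + n) y"
  by (simp add: alt_def)

lemma alt_cong: "even m = even n \<Longrightarrow> alt m y = alt n y"
  by (simp add: alt_def)

lemma alt_mult: "alt n (y :: 'a::ring) * z = alt n (y * z)" "y * alt n z = alt n (y * z)"
  by (simp_all add: alt_def)

lemma alt_sum: "alt n (sum f K) = (\<Sum>k\<in>K. alt n (f k))"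
  by (simp add: alt_def sum_negf)

lemma alt_add: "alt n (y + z) = alt n y + alt n z"
  by (simp add: alt_def)

lemma alt_minus: "alt n (- y) = - alt n y"
  by (simp add: alt_def)

lemma alt_diff: "alt n (y - z) = alt n y - alt n z"
  by (simp add: alt_def)

lemma card_symdiff_parity:
  assumes "finite S" "finite T"
  shows "even (card ((S \<union> T) - (S \<inter> T))) = even (card S + card T)"
proof -
  have "card S + card T = card (S \<union> T) + card (S \<inter> T)"
    using assms by (rule card_Un_Int)
  moreover have "card (S \<union> T) = card ((S \<union> T) - (S \<inter> T)) + card (S \<inter> T)"
    using assms by (metis card_Diff_subset card_mono finite_Int finite_UnI inf_le1 le_add_diff_inverse2
        le_infI1 sup_ge1 order_trans)
  ultimately show ?thesis by presburger
qed

lemma sum_antisym: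
  fixes g :: "'i \<Rightarrow> 'i \<Rightarrow> 'a::ab_group_add"
  shows "(\<Sum>i\<in>K. \<Sum>j\<in>K. g i j - g j i) = 0"
  by (simp add: sum_subtractf sum.swap[of g K K])

text \<open>
  The elements \<open>u\<close>, \<open>h\<close>, \<open>c\<close> play the roles of \<open>1\<close>, \<open>1/2\<close>, \<open>\<epsilon>\<close>. The unit \<open>u\<close> is only required to act as one on
  the generators, because below the ambient ring is larger than the algebra embedded in it.
\<close>

locale xp_clifford =
  fixes N :: nat and x p e :: "nat \<Rightarrow> 'r::ring" and u h c :: 'r
  assumes u_central: "\<And>y. u * y = y * u" and h_central: "\<And>y. h * y = y * h"
    and c_central: "\<And>y. c * y = y * c"
    and u_idem: "u * u = u" and h_half: "h + h = u" and c_cases: "c = u \<or> c = - u"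
    and u_x: "\<And>i. i \<in> {1..N} \<Longrightarrow> u * x i = x i"
    and u_p: "\<And>i. i \<in> {1..N} \<Longrightarrow> u * p i = p i"
    and u_e: "\<And>i. i \<in> {1..N} \<Longrightarrow> u * e i = e i"
    and xx: "\<And>i j. i \<in> {1..N} \<Longrightarrow> j \<in> {1..N} \<Longrightarrow> x i * x j = x j * x i"
    and pp: "\<And>i j. i \<in> {1..N} \<Longrightarrow> j \<in> {1..N} \<Longrightarrow> p i * p j = p j * p i"
    and ex: "\<And>i j. i \<in> {1..N} \<Longrightarrow> j \<in> {1..N} \<Longrightarrow> e i * x j = x j * e i"
    and ep: "\<And>i j. i \<in> {1..N} \<Longrightarrow> j \<in> {1..N} \<Longrightarrow> e i * p j = p j * e i"
    and ee: "\<And>i j. i \<in> {1..N} \<Longrightarrow> j \<in> {1..N} \<Longrightarrow>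
      e i * e j + e j * e i = (if i = j then c + c else 0)"
    and ham_x: "\<And>j. j \<in> {1..N} \<Longrightarrow>
      h * (\<Sum>i\<in>{1..N}. p i * p i) * x j - x j * (h * (\<Sum>i\<in>{1..N}. p i * p i)) = p j"
    and ham_p: "\<And>j. j \<in> {1..N} \<Longrightarrow>
      h * (\<Sum>i\<in>{1..N}. x i * x i) * p j - p j * (h * (\<Sum>i\<in>{1..N}. x i * x i)) = - x j"
begin

text \<open>The automorphism \<open>x \<mapsto> p\<close>, \<open>p \<mapsto> - x\<close> exchanges the roles of the two vector variables.\<close>

lemma swap: "xp_clifford N p (\<lambda>i. - x i) e u h c"
proof
  fix j assume j: "j \<in> {1..N}"
  show "h * (\<Sum>i\<in>{1..N}. - x i * - x i) * p j - p j * (h * (\<Sum>i\<in>{1..N}. - x i * - x i)) = - x j"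
    using ham_p[OF j] by simp
  show "h * (\<Sum>i\<in>{1..N}. p i * p i) * - x j - - x j * (h * (\<Sum>i\<in>{1..N}. p i * p i)) = - p j"
    using ham_x[OF j] by (simp add: algebra_simps)
qed (rule u_central h_central c_central u_idem h_half c_cases | simp add: u_x u_p u_e xx pp ex ep ee)+

text \<open>On elements fixed by \<open>u\<close> a factor 2 can be cancelled, because multiplying
  \<open>w + w\<close> by \<open>h\<close> gives \<open>u * w\<close>.\<close>

lemma halve:
  assumes "y + y = z + z" "u * y = y" "u * z = z"
  shows "y = z"
proof -
  have "h * (w + w) = u * w" for w
    by (simp add: distrib_left flip: h_half distrib_right)
  with assms show ?thesis by metis
qed

lemma u_c: "u * c = c" and c_c: "c * c = u"
  using c_cases u_idem by auto

lemma e_square: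
  assumes "i \<in> {1..N}" shows "e i * e i = c"
  using assms ee[of i i] by (rule_tac halve) (auto simp: u_e u_c simp flip: mult.assoc)

lemma e_anti:
  assumes "i \<in> {1..N}" "j \<in> {1..N}" "i \<noteq> j" shows "e j * e i = - (e i * e j)"
  using assms ee[of i j] by (simp add: eq_neg_iff_add_eq_0 add.commute)

text \<open>By the Jacobi identity \<open>[p\<^sub>i, x\<^sub>j] = [[H, x\<^sub>i], x\<^sub>j]\<close> is symmetric, where \<open>H = 1/2 \<Sum> p\<^sub>i\<^sup>2\<close>.\<close>

lemma px_sym:
  assumes "i \<in> {1..N}" "j \<in> {1..N}"
  shows "p i * x j - x j * p i = p j * x i - x i * p j"
proof -
  define H where "H = h * (\<Sum>i\<in>{1..N}. p i * p i)"
  have p: "p i = H * x i - x i * H" "p j = H * x j - x j * H"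
    using assms ham_x by (simp_all add: H_def)
  have "H * (x i * x j) = H * (x j * x i)" "x i * (x j * H) = x j * (x i * H)"
    using assms xx[of i j] by (simp_all flip: mult.assoc)
  then show ?thesis
    unfolding p by (simp add: algebra_simps)
qed

section \<open>Vector variables and Clifford monomials\<close>

definition cvec :: "(nat \<Rightarrow> 'r) \<Rightarrow> nat set \<Rightarrow> 'r" where
  "cvec y S = (\<Sum>s\<in>S. y s * e s)"

text \<open>Monomials \<open>E\<close> in the Clifford generators enter only through their index set and the resulting
  commutation signs.\<close>

definition clifford :: "nat set \<Rightarrow> 'r \<Rightarrow> bool" where
  "clifford S E \<longleftrightarrow> S \<subseteq> {1..N} \<and> u * E = E \<and> (\<forall>i\<in>{1..N}. x i * E = E * x i \<and> p i * E = E * p i \<and>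
    e i * E = alt (card S + (if i \<in> S then 1 else 0)) (E * e i))"

text \<open>This is twice the operator of the paper.\<close>

definition Op :: "nat set \<Rightarrow> 'r \<Rightarrow> 'r" where
  "Op S E = cvec p {1..N} * cvec x S * E - E * cvec x S * cvec p {1..N} - c * E"

lemma cliffordD:
  assumes "clifford S E"
  shows "S \<subseteq> {1..N}" "finite S" "u * E = E"
    "\<And>i. i \<in> {1..N} \<Longrightarrow> E * x i = x i * E"
    "\<And>i. i \<in> {1..N} \<Longrightarrow> E * p i = p i * E"
    "\<And>i. i \<in> {1..N} \<Longrightarrow> E * e i = alt (card S + (if i \<in> S then 1 else 0)) (e i * E)"
    "\<And>i. i \<in> {1..N} \<Longrightarrow> e i * E = alt (card S + (if i \<in> S then 1 else 0)) (E * e i)"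
  using assms unfolding clifford_def
  by (auto simp: alt_alt finite_subset) (auto simp: alt_def)

lemma clifford_u: "clifford {} u"
  by (simp add: clifford_def alt_def u_idem) (metis u_central)

lemma clifford_e: "a \<in> {1..N} \<Longrightarrow> clifford {a} (e a)"
  by (auto simp: clifford_def u_e ex ep alt_def intro: e_anti)

text \<open>Passing a generator through both factors adds the two exponents, and modulo 2 both
  cardinality and membership are additive under symmetric difference.\<close>

lemma clifford_mult:
  assumes E: "clifford S E" and F: "clifford T F"
  shows "clifford ((S \<union> T) - (S \<inter> T)) (E * F)"
proof -
  note E' = cliffordD[OF E] and F' = cliffordD[OF F]
  have "x i * (E * F) = E * F * x i" "p i * (E * F) = E * F * p i" if "i \<in> {1..N}" for i
    using E'(4,5)[OF that] F'(4,5)[OF that] by (metis mult.assoc)+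
  moreover have "e i * (E * F) = alt (card ((S \<union> T) - (S \<inter> T))
      + (if i \<in> (S \<union> T) - (S \<inter> T) then 1 else 0)) (E * F * e i)" if "i \<in> {1..N}" for i
  proof -
    have "e i * (E * F) = alt (card S + (if i \<in> S then 1 else 0)) (E * (e i * F))"
      unfolding mult.assoc[symmetric] E'(7)[OF that] by (simp only: alt_mult)
    also have "\<dots> = alt (card S + (if i \<in> S then 1 else 0))
        (alt (card T + (if i \<in> T then 1 else 0)) (E * F * e i))"
      unfolding F'(7)[OF that] by (simp only: alt_mult mult.assoc)
    also have "\<dots> = alt (card ((S \<union> T) - (S \<inter> T))
      + (if i \<in> (S \<union> T) - (S \<inter> T) then 1 else 0)) (E * F * e i)"
      unfolding alt_alt by (rule alt_cong) (use E'(2) F'(2) in \<open>auto simp: card_symdiff_parity\<close>)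
    finally show ?thesis .
  qed
  moreover have "u * (E * F) = E * F"
    using E'(3) by (simp flip: mult.assoc)
  moreover have "(S \<union> T) - (S \<inter> T) \<subseteq> {1..N}"
    using E'(1) F'(1) by blast
  ultimately show ?thesis
    unfolding clifford_def by blast
qed

lemma u_cvec: assumes "S \<subseteq> {1..N}" shows "u * cvec x S = cvec x S" "u * cvec p S = cvec p S"
  using assms by (auto simp: cvec_def sum_distrib_left u_x u_p simp flip: mult.assoc intro!: sum.cong)

lemma cvec_uminus: "cvec (\<lambda>i. - y i) S = - cvec y S"
  by (simp add: cvec_def sum_negf)

lemma clifford_swap: "clifford S E \<Longrightarrow> xp_clifford.clifford N p (\<lambda>i. - x i) e u S E"
  by (simp add: xp_clifford.clifford_def[OF swap] clifford_def)

text \<open>E passes \<open>x i * e i\<close> with sign (-1)^|S| for i outside S and with the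
  opposite sign for i in S. Hence the supercommutator with the full vector cancels outside S and
  doubles on S.\<close>

lemma cvec_clifford:
  assumes E: "clifford S E"
  shows "E * cvec x S = - alt (card S) (cvec x S * E)"
    and "cvec x {1..N} * E - alt (card S) (E * cvec x {1..N}) = cvec x S * E + cvec x S * E"
proof -
  note E' = cliffordD[OF E]
  have *: "E * (x i * e i) = alt (card S + (if i \<in> S then 1 else 0)) (x i * e i * E)"
    if "i \<in> {1..N}" for i
    using E'(4,6)[OF that] by (metis mult.assoc alt_mult(2))
  show "E * cvec x S = - alt (card S) (cvec x S * E)"
    unfolding cvec_def sum_distrib_left sum_distrib_right alt_sum sum_negf[symmetric]
    using E'(1) by (intro sum.cong refl) (auto simp: * alt_def)
  have "cvec x {1..N} * E - alt (card S) (E * cvec x {1..N})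
    = (\<Sum>i\<in>{1..N}. x i * e i * E - alt (card S) (E * (x i * e i)))"
    unfolding cvec_def sum_distrib_left sum_distrib_right alt_sum sum_subtractf ..
  also have "\<dots> = (\<Sum>i\<in>{1..N}. if i \<in> S then x i * e i * E + x i * e i * E else 0)"
    by (intro sum.cong refl) (auto simp: * alt_def)
  also have "\<dots> = (\<Sum>i\<in>S. x i * e i * E + x i * e i * E)"
    using E'(1) by (simp add: sum.If_cases Int_absorb1)
  also have "\<dots> = cvec x S * E + cvec x S * E"
    by (simp add: cvec_def sum_distrib_right sum.distrib)
  finally show "cvec x {1..N} * E - alt (card S) (E * cvec x {1..N}) = cvec x S * E + cvec x S * E" .
qed

section \<open>Supercommutation of the operators with D and X\<close>

lemma cvec_p_square: "cvec p {1..N} * cvec p {1..N} = c * (\<Sum>i\<in>{1..N}. p i * p i)"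
proof (rule halve)
  let ?I = "{1..N}"
  have 1: "p i * e i * (p j * e j) = p i * p j * (e i * e j)" if "i \<in> ?I" "j \<in> ?I" for i j
    using ep[OF that] by (metis mult.assoc)
  have "cvec p ?I * cvec p ?I = (\<Sum>i\<in>?I. \<Sum>j\<in>?I. p i * p j * (e i * e j))"
    unfolding cvec_def sum_product by (intro sum.cong refl) (simp add: 1)
  \<comment> \<open>As the \<open>p i\<close> commute, renaming the indices exchanges only the
    generators. Adding both forms leaves anticommutators, of which the diagonal survives.\<close>
  moreover have "\<dots> = (\<Sum>i\<in>?I. \<Sum>j\<in>?I. p i * p j * (e j * e i))"
    by (subst sum.swap) (auto intro!: sum.cong simp: pp)
  ultimately have "cvec p ?I * cvec p ?I + cvec p ?I * cvec p ?I
    = (\<Sum>i\<in>?I. \<Sum>j\<in>?I. p i * p j * (e i * e j + e j * e i))"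
    by (simp add: sum.distrib distrib_left)
  also have "\<dots> = (\<Sum>i\<in>?I. \<Sum>j\<in>?I. if i = j then p i * p j * (c + c) else 0)"
    by (intro sum.cong refl) (simp add: ee)
  also have "\<dots> = c * (\<Sum>i\<in>?I. p i * p i) + c * (\<Sum>i\<in>?I. p i * p i)"
    by (simp add: sum_distrib_left distrib_left sum.distrib c_central)
  finally show "cvec p ?I * cvec p ?I + cvec p ?I * cvec p ?I = \<dots>" .
qed (simp_all add: u_cvec u_c flip: mult.assoc)

text \<open>With Q the sum of the squares of the \<open>p i\<close>, D^2 = c Q. Commuting Q past x_S
  leaves the extra term 2 c p_S E, and the summand - c E of \<open>Op\<close> contributes -c (D E -
  (-1)^|S| E D) = - 2 c p_S E, which cancels it.\<close>

lemma Op_supercommute_p: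
  assumes E: "clifford S E"
  shows "cvec p {1..N} * Op S E = alt (card S) (Op S E * cvec p {1..N})"
proof -
  note E' = cliffordD[OF E]
  let ?I = "{1..N}"
  interpret swap: xp_clifford N p "\<lambda>i. - x i" e u h c by (rule swap)
  define D Q where "D = cvec p ?I" and "Q = (\<Sum>i\<in>?I. p i * p i)"
  have DD: "D * D = c * Q"
    unfolding D_def Q_def by (rule cvec_p_square)
  have QE: "Q * E = E * Q"
    unfolding Q_def sum_distrib_left sum_distrib_right
    by (intro sum.cong refl) (metis E'(5) mult.assoc)
  have Qx: "Q * x j = x j * Q + (p j + p j)" if j: "j \<in> ?I" for j
  proof -
    have "p j + p j = (h + h) * Q * x j - x j * ((h + h) * Q)"
      using ham_x[OF j] by (simp add: Q_def algebra_simps)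
    moreover have "u * Q = Q"
      by (auto simp: Q_def sum_distrib_left u_p simp flip: mult.assoc)
    ultimately show ?thesis by (simp add: h_half)
  qed
  have Qe: "Q * e j = e j * Q" if j: "j \<in> ?I" for j
    unfolding Q_def sum_distrib_left sum_distrib_right
    by (intro sum.cong refl) (metis ep j mult.assoc)
  have Qv: "Q * cvec x S = cvec x S * Q + (cvec p S + cvec p S)"
  proof -
    have "Q * (x j * e j) = x j * e j * Q + (p j * e j + p j * e j)" if "j \<in> S" for j
    proof -
      have j: "j \<in> ?I" using that E' by auto
      have "Q * (x j * e j) = Q * x j * e j" by (simp add: mult.assoc)
      also have "\<dots> = x j * (Q * e j) + (p j * e j + p j * e j)"
        unfolding Qx[OF j] by (simp add: algebra_simps)
      finally show ?thesis by (simp add: Qe[OF j] mult.assoc)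
    qed
    then show ?thesis
      unfolding cvec_def sum_distrib_left sum_distrib_right sum.distrib[symmetric]
      by (intro sum.cong) simp_all
  qed
  have Ev: "E * cvec x S = - alt (card S) (cvec x S * E)"
    by (rule cvec_clifford[OF E])
  \<comment> \<open>The bracket of the full vector with E, read with p in place of x.\<close>
  have DE: "D * E = alt (card S) (E * D) + (cvec p S * E + cvec p S * E)"
    using swap.cvec_clifford(2)[OF clifford_swap[OF E]] unfolding D_def
    by (simp add: algebra_simps)
  have Op: "Op S E = D * (cvec x S * E) + alt (card S) (cvec x S * E * D) - c * E"
    unfolding Op_def D_def[symmetric] Ev by (simp add: alt_mult mult.assoc)
  have 1: "D * Op S E = c * (cvec x S * (E * Q)) + (c * (cvec p S * E) + c * (cvec p S * E))
      + alt (card S) (D * (cvec x S * (E * D))) - c * (D * E)"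
  proof -
    have "D * (D * (cvec x S * E)) = c * (Q * cvec x S * E)"
      by (simp add: DD flip: mult.assoc)
    also have "\<dots> = c * (cvec x S * (E * Q)) + (c * (cvec p S * E) + c * (cvec p S * E))"
      unfolding Qv by (simp add: algebra_simps QE)
    finally show ?thesis
      unfolding Op by (simp add: algebra_simps alt_mult) (metis c_central mult.assoc)
  qed
  have 2: "alt (card S) (Op S E * D) = alt (card S) (D * (cvec x S * (E * D)))
      + c * (cvec x S * (E * Q)) - c * alt (card S) (E * D)"
  proof -
    have "cvec x S * (E * (D * D)) = c * (cvec x S * (E * Q))"
      unfolding DD by (metis c_central mult.assoc)
    then show ?thesis
      unfolding Op by (simp add: algebra_simps alt_mult alt_alt alt_add alt_diff) (simp add: alt_def)
  qed
  show ?thesis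
    unfolding D_def[symmetric] 1 2 DE by (simp add: algebra_simps)
qed

text \<open>Clifford factors commute with all x and p, so they can be collected on the right; the
  order of \<open>p i\<close> and \<open>x a\<close> is kept.\<close>

lemma Op_double_sum:
  assumes E: "clifford S E"
  shows "Op S E = (\<Sum>a\<in>S. \<Sum>i\<in>{1..N}. p i * x a * (e i * e a * E) - x a * p i * (E * e a * e i)) - c * E"
proof -
  note E' = cliffordD[OF E]
  let ?I = "{1..N}"
  have "cvec p ?I * cvec x S * E = (\<Sum>a\<in>S. \<Sum>i\<in>?I. p i * x a * (e i * e a * E))"
  proof -
    have "p i * e i * (x a * e a) * E = p i * x a * (e i * e a * E)" if "i \<in> ?I" "a \<in> S" for i a
    proof -
      have "p i * e i * (x a * e a) * E = p i * (e i * x a) * (e a * E)"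
        by (simp only: mult.assoc)
      also have "e i * x a = x a * e i"
        using that E'(1) by (intro ex) auto
      finally show ?thesis by (simp only: mult.assoc)
    qed
    then show ?thesis
      unfolding cvec_def sum_product by (subst sum.swap) (simp add: sum_distrib_right)
  qed
  moreover have "E * cvec x S * cvec p ?I = (\<Sum>a\<in>S. \<Sum>i\<in>?I. x a * p i * (E * e a * e i))"
  proof -
    have "E * (x a * e a) * (p i * e i) = x a * p i * (E * e a * e i)" if "i \<in> ?I" "a \<in> S" for i a
    proof -
      have a: "a \<in> ?I" using that E'(1) by auto
      have "E * (x a * e a) * (p i * e i) = x a * (E * (p i * e a) * e i)"
        using E'(4)[OF a] ep[OF a that(1)] by (metis mult.assoc)
      then show ?thesis
        using E'(5)[OF that(1)] by (metis mult.assoc)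
    qed
    then show ?thesis
      unfolding cvec_def sum_distrib_left[of E] sum_product by simp
  qed
  ultimately show ?thesis
    by (simp add: Op_def sum_subtractf)
qed

text \<open>The signs from moving both generators past E multiply to +1 for i in S and to -1
  otherwise; in the second case exchanging the generators absorbs the sign.\<close>

lemma clifford_ee:
  assumes E: "clifford S E" and "i \<in> {1..N}" "a \<in> S" "i \<noteq> a"
  shows "E * e a * e i = (if i \<in> S then e a * e i * E else e i * e a * E)"
proof -
  note E' = cliffordD[OF E]
  have a: "a \<in> {1..N}" using assms E' by auto
  have "E * e a * e i = - alt (card S) (e a * (E * e i))"
    using E'(6)[OF a] assms(3) by (simp add: mult.assoc alt_def)
  then show ?thesis
    using E'(6)[OF assms(2)] e_anti[OF a assms(2)] assms(4)
    by (auto simp: alt_def simp flip: mult.assoc)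
qed

text \<open>The difference of the two sides is a sum over pairs of \<open>[p\<^sub>i, x\<^sub>a] - [p\<^sub>a, x\<^sub>i] = 0\<close> for \<open>i \<notin> S\<close> and an
  antisymmetric double sum over \<open>S\<close>.\<close>

lemma Op_swap:
  assumes E: "clifford S E"
  shows "xp_clifford.Op N p (\<lambda>i. - x i) e c S E = Op S E"
proof -
  interpret swap: xp_clifford N p "\<lambda>i. - x i" e u h c by (rule swap)
  note E' = cliffordD[OF E]
  let ?I = "{1..N}"
  define T where "T y z i a = y i * z a * (e i * e a * E) - z a * y i * (E * e a * e i)"
    for y z :: "nat \<Rightarrow> 'r" and i a
  \<comment> \<open>For i in S, E e_a e_i = e_a e_i E, so the terms in which the generators are
    exchanged make up \<open>g a i\<close>.\<close>
  define g where "g i a = (p i * x a + x i * p a) * (e i * e a * E)" for i a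
  have 1: "T p x i a - T (\<lambda>i. - x i) p i a = (if i \<in> S then g i a - g a i else 0)"
    if "a \<in> S" "i \<in> ?I" for a i
  proof -
    have a: "a \<in> ?I" using that E' by auto
    show ?thesis
    proof (cases "i = a")
      case True
      then have "E * e a * e i = e i * e a * E"
        using that E'(6)[of a] a E'(3)
        by (metis c_central e_square mult.assoc)
      with True that show ?thesis
        by (simp add: T_def algebra_simps)
    next
      case False
      show ?thesis
      proof (cases "i \<in> S")
        case True
        then show ?thesis
          using that unfolding T_def g_def clifford_ee[OF E that(2,1) False]
          by (simp add: algebra_simps)
      next
        case i: False
        have "T p x i a - T (\<lambda>i. - x i) p i a
          = ((p i * x a - x a * p i) - (p a * x i - x i * p a)) * (e i * e a * E)"
          using i unfolding T_def clifford_ee[OF E that(2,1) False] by (simp add: algebra_simps)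
        then show ?thesis
          using px_sym[OF that(2) a] i by simp
      qed
    qed
  qed
  have "Op S E - swap.Op S E = (\<Sum>a\<in>S. \<Sum>i\<in>?I. T p x i a - T (\<lambda>i. - x i) p i a)"
    using Op_double_sum[OF E] swap.Op_double_sum[OF clifford_swap[OF E]]
    by (simp add: T_def sum_subtractf)
  also have "\<dots> = (\<Sum>a\<in>S. \<Sum>i\<in>?I. if i \<in> S then g i a - g a i else 0)"
    by (intro sum.cong refl 1)
  also have "\<dots> = (\<Sum>a\<in>S. \<Sum>i\<in>S. g i a - g a i)"
    using E'(1) by (simp add: sum.If_cases Int_absorb1)
  also have "\<dots> = 0"
    by (rule trans[OF sum.swap sum_antisym])
  finally show ?thesis by simp
qed

text \<open>The supercommutation with \<open>cvec p {1..N}\<close> after the substitution, which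
  fixes \<open>Op S E\<close> and turns \<open>cvec p {1..N}\<close> into
  \<open>- cvec x {1..N}\<close>.\<close>

lemma Op_supercommute_x:
  assumes E: "clifford S E"
  shows "cvec x {1..N} * Op S E = alt (card S) (Op S E * cvec x {1..N})"
  using xp_clifford.Op_supercommute_p[OF swap clifford_swap[OF E]]
  by (simp add: Op_swap[OF E] cvec_uminus alt_def split: if_splits) (metis minus_minus)

text \<open>\<open>proj n w\<close> is \<open>[D, [X, w]] - 2 \<epsilon> w\<close> with supercommutators, for \<open>w\<close> of parity \<open>n\<close>.\<close>

definition proj :: "nat \<Rightarrow> 'r \<Rightarrow> 'r" where
  "proj n w = cvec p {1..N} * (cvec x {1..N} * w - alt n (w * cvec x {1..N}))
    + alt n ((cvec x {1..N} * w - alt n (w * cvec x {1..N})) * cvec p {1..N}) - (c * w + c * w)"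

text \<open>The inner bracket is 2 x_S E, and (-1)^|S| x_S E = - E x_S restores the second term of
  \<open>Op\<close>.\<close>

lemma proj_Op:
  assumes E: "clifford S E"
  shows "proj (card S) E = Op S E + Op S E"
  unfolding proj_def cvec_clifford(2)[OF E] Op_def cvec_clifford(1)[OF E]
  by (simp add: algebra_simps alt_mult alt_add)

lemma proj_diff: "proj n (w - z) = proj n w - proj n z"
  by (simp add: proj_def algebra_simps alt_add alt_diff)

lemma proj_alt: "proj n (alt m w) = alt m (proj n w)"
  by (auto simp: proj_def alt_def algebra_simps)

text \<open>By the super Leibniz rule: every term in which a bracket hits v vanishes.\<close>

lemma proj_mult:
  assumes "cvec p {1..N} * v = alt m (v * cvec p {1..N})" "cvec x {1..N} * v = alt m (v * cvec x {1..N})"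
  shows "proj (m + n) (v * w) = v * proj n w" "proj (n + m) (w * v) = proj n w * v"
proof -
  define D X where "D = cvec p {1..N}" and "X = cvec x {1..N}"
  have v: "D * v = alt m (v * D)" "X * v = alt m (v * X)"
    using assms by (simp_all add: D_def X_def)
  have v': "D * (v * z) = alt m (v * (D * z))" "X * (v * z) = alt m (v * (X * z))" for z
    using v by (metis alt_mult(1) mult.assoc)+
  have c: "c * (v * z) = v * (c * z)" for z
    by (metis c_central mult.assoc)
  note proj = proj_def[folded D_def X_def]
  show "proj (m + n) (v * w) = v * proj n w"
    by (cases "even m"; cases "even n") (simp_all add: proj alt_def algebra_simps c v'[unfolded alt_def])
  show "proj (n + m) (w * v) = proj n w * v"
    by (cases "even m"; cases "even n") (simp_all add: proj alt_def algebra_simps v[unfolded alt_def]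
      v'[unfolded alt_def])
qed

lemma u_Op:
  assumes E: "clifford S E"
  shows "u * Op S E = Op S E"
proof -
  have "u * (cvec p {1..N} * cvec x S * E) = cvec p {1..N} * cvec x S * E"
    by (simp add: u_cvec flip: mult.assoc)
  moreover have "u * (E * cvec x S * cvec p {1..N}) = E * cvec x S * cvec p {1..N}"
    using cliffordD(3)[OF E] by (simp flip: mult.assoc)
  moreover have "u * (c * E) = c * E"
    by (simp add: u_c flip: mult.assoc)
  ultimately show ?thesis
    by (simp add: Op_def right_diff_distrib)
qed

text \<open>As \<open>v = Op S E\<close> supercommutes with \<open>cvec p\<close> and \<open>cvec x\<close>, it can be moved into the map \<^term>\<open>proj\<close>,
  so the bracket of two operators only depends on the bracket of \<open>v\<close> with a Clifford monomial.\<close>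

lemma Op_bracket:
  assumes E: "clifford S E" and F: "clifford T F"
  shows "(Op S E * Op T F - alt n (Op T F * Op S E)) + (Op S E * Op T F - alt n (Op T F * Op S E))
    = proj (card S + card T) (Op S E * F - alt n (F * Op S E))"
proof -
  note v = Op_supercommute_p[OF E] Op_supercommute_x[OF E]
  have "proj (card S + card T) (F * Op S E) = proj (card T) F * Op S E"
    using proj_mult(2)[OF v, of "card T" F] by (simp add: add.commute)
  then show ?thesis
    unfolding proj_diff proj_alt proj_mult(1)[OF v] proj_Op[OF F]
    by (simp add: algebra_simps alt_add)
qed

section \<open>Brackets of an operator with a Clifford monomial\<close>

lemma Op_monomial_bracket:
  assumes E: "clifford S E" and F: "clifford T F" and "S \<subseteq> T" and EF: "E * F = alt n (F * E)"
  defines "K \<equiv> \<lambda>i a. (p i * x a - x a * p i) * (e i * e a * (E * F))"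
  shows "Op S E * F - alt n (F * Op S E) = (\<Sum>a\<in>S. \<Sum>i\<in>{1..N} - T. K i a + K i a)"
proof -
  note E' = cliffordD[OF E] and F' = cliffordD[OF F]
  let ?I = "{1..N}"
  define Z where "Z i a = p i * x a * (e i * e a * E) - x a * p i * (E * e a * e i)" for i a
  have F_x: "F * (y * w) = y * (F * w)" if "y \<in> x ` ?I \<union> p ` ?I" for y w
    using F'(4,5) that by (metis (no_types, lifting) UnE imageE mult.assoc)
  \<comment> \<open>Each generator in T passes F with sign (-1)^(|T|+1), each other one with
    (-1)^|T|. As a lies in T, the signs multiply to -1 exactly when i is outside T.\<close>
  have F_ee: "F * (e i * (e a * w)) = (if i \<in> T then e i * (e a * (F * w)) else - (e i * (e a * (F * w))))"
    if "i \<in> ?I" "a \<in> S" for i a w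
  proof -
    have a: "a \<in> ?I" "a \<in> T" using that assms(3) E'(1) by auto
    have "F * (e i * (e a * w)) = alt (card T + (if i \<in> T then 1 else 0)) (e i * (F * (e a * w)))"
      using F'(6)[OF that(1)] by (metis mult.assoc alt_mult(1))
    also have "F * (e a * w) = alt (card T + 1) (e a * (F * w))"
      using F'(6)[OF a(1)] a(2) by (simp add: alt_mult flip: mult.assoc)
    finally show ?thesis by (simp add: alt_mult alt_alt) (auto simp: alt_def)
  qed
  \<comment> \<open>The factor (-1)^n undoes the exchange of E and F, so only the sign of
    \<open>e i * e a\<close> past F remains: terms with i in T cancel, the others double.\<close>
  have Z: "Z i a * F - alt n (F * Z i a) = (if i \<in> T then 0 else K i a + K i a)"
    if "i \<in> ?I" "a \<in> S" for i a
  proof -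
    have a: "a \<in> ?I" "a \<in> T" using that assms(3) E'(1) by auto
    have px: "F * (p i * (x a * w)) = p i * (x a * (F * w))" "F * (x a * (p i * w)) = x a * (p i * (F * w))" for w
      using that a by (simp_all add: F_x)
    have FE: "F * E = alt n (E * F)"
      unfolding EF alt_alt by (simp add: alt_def)
    \<comment> \<open>For i in T any sign will do, as the term cancels. For i outside T an even q
      makes the coefficient in B the commutator [p_i, x_a].\<close>
    have ee: "\<exists>q. E * e a * e i = alt q (e i * e a * E) \<and> (i \<notin> T \<longrightarrow> even q)"
    proof (cases "i = a")
      case True
      then have "E * e a * e i = alt 0 (e i * e a * E)"
        using e_square[OF a(1)] by (simp add: alt_def c_central mult.assoc)
      then show ?thesis by (intro exI[of _ 0]) simp
    next
      case False
      then have "e a * e i = - (e i * e a)"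
        using that a by (intro e_anti) auto
      then have "E * e a * e i = alt (if i \<in> S then 1 else 0) (e i * e a * E)"
        using clifford_ee[OF E that False] by (simp add: alt_def)
      moreover have "i \<notin> T \<longrightarrow> i \<notin> S" using assms(3) by auto
      ultimately show ?thesis by (intro exI[of _ "if i \<in> S then 1 else 0"]) simp
    qed
    then obtain q where q: "E * e a * e i = alt q (e i * e a * E)" "i \<notin> T \<longrightarrow> even q"
      by blast
    define B where "B = (p i * x a - alt q (x a * p i)) * (e i * e a)"
    have Z: "Z i a = B * E"
      unfolding Z_def q(1) B_def by (simp add: algebra_simps alt_mult)
    have FB: "F * (B * E) = (if i \<in> T then B * (F * E) else - (B * (F * E)))"
      unfolding B_def by (simp add: algebra_simps alt_mult alt_minus px F_ee[OF that])
    show ?thesis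
    proof (cases "i \<in> T")
      case True
      then show ?thesis
        unfolding Z FB FE by (simp add: alt_mult alt_alt mult.assoc) (simp add: alt_def)
    next
      case False
      then have "K i a = B * (E * F)"
        using q(2) by (simp add: K_def B_def alt_def mult.assoc)
      then show ?thesis
        using False unfolding Z FB FE by (simp add: alt_mult alt_alt mult.assoc) (simp add: alt_def)
    qed
  qed
  have "Op S E * F - alt n (F * Op S E) = (\<Sum>a\<in>S. \<Sum>i\<in>?I. Z i a * F - alt n (F * Z i a))
    - (c * E * F - alt n (F * (c * E)))"
    unfolding Op_double_sum[OF E] Z_def[symmetric]
    by (simp add: left_diff_distrib right_diff_distrib sum_distrib_left sum_distrib_right alt_sum alt_diff
        sum_subtractf)
  also have "alt n (F * (c * E)) = c * E * F"
    using EF by (metis alt_mult(2) c_central mult.assoc)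
  also have "(\<Sum>a\<in>S. \<Sum>i\<in>?I. Z i a * F - alt n (F * Z i a))
      = (\<Sum>a\<in>S. \<Sum>i\<in>?I. if i \<in> T then 0 else K i a + K i a)"
    by (intro sum.cong refl Z)
  also have "\<dots> = (\<Sum>a\<in>S. \<Sum>i\<in>?I - T. K i a + K i a)"
    by (rule sum.cong[OF refl], rule sum.mono_neutral_cong_right) auto
  finally show ?thesis by simp
qed

text \<open>Every Clifford word contains e_a twice in succession, and its square c is central, so
  each word reduces to c e_i.\<close>

lemma Op_single:
  assumes a: "a \<in> {1..N}"
  shows "Op {a} (e a) = c * ((\<Sum>i\<in>{1..N}. (p i * x a - x a * p i) * e i) - e a)"
proof -
  have "p i * x a * (e i * e a * e a) - x a * p i * (e a * e a * e i)
    = c * ((p i * x a - x a * p i) * e i)" for i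
  proof -
    have "p i * x a * (e i * e a * e a) = p i * x a * (c * e i)"
      using e_square[OF a] by (simp add: mult.assoc flip: c_central)
    moreover have "y * z * (c * w) = c * (y * z * w)" for y z w
      by (metis c_central mult.assoc)
    ultimately show ?thesis
      by (simp add: e_square[OF a] left_diff_distrib right_diff_distrib)
  qed
  then show ?thesis
    using Op_double_sum[OF clifford_e[OF a]] by (simp add: right_diff_distrib sum_distrib_left)
qed

text \<open>Generators in T pass F with the sign of this bracket, so their terms cancel, including
  that of \<open>e a\<close>; the remaining generators pass with the opposite sign and
  double.\<close>

lemma Op_single_monomial_bracket:
  assumes F: "clifford T F" and "a \<in> T"
  defines "K \<equiv> \<lambda>i. (p i * x a - x a * p i) * (e i * F)"
  shows "Op {a} (e a) * F - alt (card T + 1) (F * Op {a} (e a)) = c * (\<Sum>i\<in>{1..N} - T. K i + K i)"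
proof -
  note F' = cliffordD[OF F]
  let ?I = "{1..N}" and ?C = "\<lambda>i. p i * x a - x a * p i"
  have a: "a \<in> ?I" using assms(2) F'(1) by auto
  have *: "?C i * e i * F - alt (card T + 1) (F * (?C i * e i)) = (if i \<in> T then 0 else K i + K i)"
    if "i \<in> ?I" for i
  proof -
    have FC: "F * ?C i = ?C i * F"
      using F'(4)[OF a] F'(5)[OF that] unfolding left_diff_distrib right_diff_distrib
      by (metis mult.assoc)
    have "F * (?C i * e i) = alt (card T + (if i \<in> T then 1 else 0)) (?C i * (e i * F))"
      unfolding mult.assoc[symmetric, of F] FC unfolding mult.assoc F'(6)[OF that] alt_mult(2) ..
    then show ?thesis
      by (simp add: alt_alt K_def mult.assoc) (simp add: alt_def)
  qed
  have "F * e a = alt (card T + 1) (e a * F)"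
    using F'(6)[OF a] assms(2) by simp
  then have **: "alt (card T + 1) (F * e a) = e a * F"
    by (simp only: alt_alt) (simp add: alt_def)
  have Fc: "F * (c * w) = c * (F * w)" for w
    by (metis c_central mult.assoc)
  have "Op {a} (e a) * F - alt (card T + 1) (F * Op {a} (e a))
    = c * ((\<Sum>i\<in>?I. ?C i * e i * F - alt (card T + 1) (F * (?C i * e i)))
        - (e a * F - alt (card T + 1) (F * e a)))"
    unfolding Op_single[OF a] Fc
    by (simp only: left_diff_distrib right_diff_distrib sum_distrib_left sum_distrib_right alt_sum
        alt_diff sum_subtractf mult.assoc flip: alt_mult(2)) (simp add: algebra_simps)
  also have "\<dots> = c * (\<Sum>i\<in>?I. if i \<in> T then 0 else K i + K i)"
    by (simp only: ** diff_self diff_0_right sum.cong[OF refl *])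
  also have "(\<Sum>i\<in>?I. if i \<in> T then 0 else K i + K i) = (\<Sum>i\<in>?I - T. K i + K i)"
    by (rule sum.mono_neutral_cong_right) auto
  finally show ?thesis .
qed

lemma proj_c_sum: "proj n (c * sum f K) = c * (\<Sum>k\<in>K. proj n (f k))"
proof -
  have c: "cvec y S * (c * w) = c * (cvec y S * w)" for y S w
    by (metis c_central mult.assoc)
  have "proj n (c * w) = c * proj n w" for w
    by (cases "even n") (simp_all add: proj_def alt_def algebra_simps c)
  moreover have "proj n (sum f K) = (\<Sum>k\<in>K. proj n (f k))"
    unfolding proj_def
    by (simp only: left_diff_distrib right_diff_distrib sum_distrib_left sum_distrib_right alt_sum
        alt_diff sum_subtractf sum.distrib)
  ultimately show ?thesis by simp
qed

text \<open>After doubling, both sides are \<open>proj\<close> of a double sum of K. On the left i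
  ranges outside T, on the right outside T - S and different from a. The surplus pairs on the right,
  with i and a distinct in S, cancel in the sum over a.\<close>

lemma Op_bracket_subset:
  assumes E: "clifford S E" and F: "clifford T F" and ST: "S \<subseteq> T" and EF: "E * F = alt n (F * E)"
  defines "T' \<equiv> \<lambda>a. insert a (T - S)" and "G \<equiv> \<lambda>a. e a * (E * F)"
  shows "Op S E * Op T F - alt n (Op T F * Op S E) =
    c * (\<Sum>a\<in>S. Op {a} (e a) * Op (T' a) (G a) - alt (card (T' a) + 1) (Op (T' a) (G a) * Op {a} (e a)))"
    (is "?L = c * (\<Sum>a\<in>S. ?R a)")
proof (rule halve)
  note E' = cliffordD[OF E] and F' = cliffordD[OF F]
  let ?I = "{1..N}"
  define K where "K i a = (p i * x a - x a * p i) * (e i * e a * (E * F))" for i a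
  have aI: "a \<in> ?I" if "a \<in> S" for a using that E' by auto
  have G: "clifford (T' a) (G a)" if "a \<in> S" for a
  proof -
    \<comment> \<open>The index set of e_a E F, where a lies in S and S in T.\<close>
    have "({a} \<union> (S \<union> T - S \<inter> T)) - ({a} \<inter> (S \<union> T - S \<inter> T)) = T' a"
      using that ST by (auto simp: T'_def)
    then show ?thesis
      using clifford_mult[OF clifford_e[OF aI[OF that]] clifford_mult[OF E F]] by (simp add: G_def)
  qed
  have "(\<Sum>a\<in>S. \<Sum>i\<in>?I - T' a. K i a + K i a)
    = (\<Sum>a\<in>S. (\<Sum>i\<in>?I - T. K i a + K i a) + (\<Sum>i\<in>S. K i a - K a i))"
  proof (rule sum.cong[OF refl])
    fix a assume a: "a \<in> S"
    \<comment> \<open>A product of the symmetric [p_i, x_a] and the antisymmetric e_i e_a.\<close>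
    have K: "K a i = - K i a" if "i \<in> S - {a}" for i
      using that a aI px_sym[of i a] e_anti[of i a] by (auto simp: K_def)
    have "?I - T' a = (?I - T) \<union> (S - {a})"
      using a E'(1) ST by (auto simp: T'_def)
    then have "(\<Sum>i\<in>?I - T' a. K i a + K i a)
      = (\<Sum>i\<in>?I - T. K i a + K i a) + (\<Sum>i\<in>S - {a}. K i a + K i a)"
      using ST E'(2) by (simp only:, intro sum.union_disjoint) auto
    also have "(\<Sum>i\<in>S - {a}. K i a + K i a) = (\<Sum>i\<in>S - {a}. K i a - K a i)"
      by (rule sum.cong) (auto simp: K)
    also have "\<dots> = (\<Sum>i\<in>S. K i a - K a i)"
      using E'(2) by (intro sum.mono_neutral_left) auto
    finally show "(\<Sum>i\<in>?I - T' a. K i a + K i a)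
      = (\<Sum>i\<in>?I - T. K i a + K i a) + (\<Sum>i\<in>S. K i a - K a i)" .
  qed
  also have "\<dots> = (\<Sum>a\<in>S. \<Sum>i\<in>?I - T. K i a + K i a)"
    using sum.swap[of "\<lambda>a i. K i a - K a i" S S] sum_antisym[of K S] by (simp add: sum.distrib)
  finally have K: "(\<Sum>a\<in>S. \<Sum>i\<in>?I - T' a. K i a + K i a) = \<dots>" .

  have GG: "proj (card S + card T) (Op {a} (e a) * G a - alt (card (T' a) + 1) (G a * Op {a} (e a)))
    = ?R a + ?R a" if a: "a \<in> S" for a
  proof -
    \<comment> \<open>Here |T' a| = |T| - |S| + 1. As \<open>proj\<close> depends only on the parity
      of its first argument, the same \<open>proj\<close> serves for every a and for the left
      side.\<close>
    have "even (1 + card (T' a)) = even (card S + card T)"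
      using card_mono[OF F'(2) ST] E'(2) F'(2) ST a by (auto simp: T'_def card_Diff_subset)
    then have "proj (card S + card T) = proj (1 + card (T' a))"
      by (simp add: fun_eq_iff proj_def alt_def)
    then show ?thesis
      using Op_bracket[OF clifford_e[OF aI[OF a]] G[OF a]] by simp
  qed
  have "?L + ?L = proj (card S + card T) (\<Sum>a\<in>S. \<Sum>i\<in>?I - T. K i a + K i a)"
    unfolding Op_bracket[OF E F] Op_monomial_bracket[OF E F ST EF] K_def ..
  also have "(\<Sum>a\<in>S. \<Sum>i\<in>?I - T. K i a + K i a)
    = c * (\<Sum>a\<in>S. Op {a} (e a) * G a - alt (card (T' a) + 1) (G a * Op {a} (e a)))"
  proof -
    have "(\<Sum>a\<in>S. Op {a} (e a) * G a - alt (card (T' a) + 1) (G a * Op {a} (e a)))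
      = (\<Sum>a\<in>S. c * (\<Sum>i\<in>?I - T' a. K i a + K i a))"
      by (intro sum.cong refl, subst Op_single_monomial_bracket[OF G])
        (auto simp: T'_def K_def G_def mult.assoc)
    also have "\<dots> = c * (\<Sum>a\<in>S. \<Sum>i\<in>?I - T. K i a + K i a)"
      unfolding sum_distrib_left[symmetric] K ..
    \<comment> \<open>The c of the claim and the c from the brackets with O_a multiply to
      \<open>u\<close>, which must act trivially on the double sum.\<close>
    moreover have "u * (\<Sum>a\<in>S. \<Sum>i\<in>?I - T. K i a + K i a) = (\<Sum>a\<in>S. \<Sum>i\<in>?I - T. K i a + K i a)"
    proof -
      have "u * K i a = K i a" if "a \<in> S" "i \<in> ?I" for i a
        unfolding K_def by (metis E'(3) u_central mult.assoc)
      then show ?thesis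
        unfolding sum_distrib_left distrib_left by (intro sum.cong refl) auto
    qed
    ultimately show ?thesis
      by (simp add: c_c flip: mult.assoc)
  qed
  also have "proj (card S + card T) \<dots> = c * (\<Sum>a\<in>S. ?R a + ?R a)"
    unfolding proj_c_sum by (rule arg_cong[OF sum.cong[OF refl GG]])
  finally show "?L + ?L = c * (\<Sum>a\<in>S. ?R a) + c * (\<Sum>a\<in>S. ?R a)"
    by (simp only: sum.distrib distrib_left)
  have u_alt: "u * alt m w = alt m (u * w)" for m w
    by (simp add: alt_mult)
  show "u * ?L = ?L"
    by (simp add: right_diff_distrib u_alt u_Op[OF E] u_Op[OF F] flip: mult.assoc)
  show "u * (c * (\<Sum>a\<in>S. ?R a)) = c * (\<Sum>a\<in>S. ?R a)"
    by (simp add: u_c flip: mult.assoc)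
qed

section \<open>Ordered products of generators and their commutation signs\<close>

definition e_prod :: "nat list \<Rightarrow> 'r" where
  "e_prod A = foldr (*) (map e A) u"

lemma clifford_e_prod:
  "distinct A \<Longrightarrow> set A \<subseteq> {1..N} \<Longrightarrow> clifford (set A) (e_prod A)"
proof (induction A)
  case Nil
  then show ?case by (simp add: e_prod_def clifford_u)
next
  case (Cons a A)
  have a: "({a} \<union> set A) - ({a} \<inter> set A) = set (a # A)" "a \<in> {1..N}"
    using Cons.prems by auto
  have "clifford (set A) (e_prod A)"
    using Cons by auto
  from clifford_mult[OF clifford_e[OF a(2)] this] show ?case
    unfolding a(1) by (simp only: e_prod_def list.map foldr_Cons comp_apply)
qed

text \<open>The generators of B are passed one at a time, each contributing |S| to the exponent and
  one more if it lies in S.\<close>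

lemma e_prod_commute:
  assumes E: "clifford S E" and B: "distinct B" "set B \<subseteq> {1..N}"
  shows "E * e_prod B = alt (card S * card (set B) + card (S \<inter> set B)) (e_prod B * E)"
  using B
proof (induction B)
  case Nil
  have "E * u = u * E" by (rule u_central[symmetric])
  then show ?case by (simp add: e_prod_def alt_def)
next
  case (Cons b B)
  have b: "b \<in> {1..N}" "b \<notin> set B" using Cons.prems by auto
  have IH: "E * e_prod B = alt (card S * card (set B) + card (S \<inter> set B)) (e_prod B * E)"
    using Cons by auto
  have "E * (e b * e_prod B) = E * e b * e_prod B"
    by (simp only: mult.assoc)
  also have "\<dots> = alt (card S + (if b \<in> S then 1 else 0)) (e b * (E * e_prod B))"
    unfolding cliffordD(6)[OF E b(1)] by (simp only: alt_mult mult.assoc)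
  also have "\<dots> = alt (card S + (if b \<in> S then 1 else 0)
      + (card S * card (set B) + card (S \<inter> set B))) (e b * e_prod B * E)"
    unfolding IH by (simp only: alt_mult alt_alt mult.assoc)
  also have "\<dots> = alt (card S * card (set (b # B)) + card (S \<inter> set (b # B))) (e b * e_prod B * E)"
    by (rule alt_cong) (use b cliffordD(2)[OF E] in \<open>auto simp: Int_insert_right\<close>)
  finally show ?case by (simp add: e_prod_def)
qed

lemma e_prod_swap:
  assumes A: "distinct A" "set A \<subseteq> {1..N}" and B: "distinct B" "set B \<subseteq> {1..N}"
  shows "e_prod A * e_prod B =
    alt (card (set A) * card (set B) - card (set A \<inter> set B)) (e_prod B * e_prod A)"
proof -
  \<comment> \<open>With this bound the subtraction of natural numbers does not truncate, so
    difference and sum have the same parity.\<close>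
  have "card (set A \<inter> set B) \<le> card (set A) * card (set B)"
  proof (cases "B = []")
    case False
    then have "1 \<le> card (set B)" by (simp add: Suc_le_eq card_gt_0_iff)
    then have "card (set A) * 1 \<le> card (set A) * card (set B)" by (rule mult_le_mono2)
    moreover have "card (set A \<inter> set B) \<le> card (set A)" by (rule card_mono) auto
    ultimately show ?thesis by linarith
  qed simp
  then show ?thesis
    unfolding e_prod_commute[OF clifford_e_prod[OF A] B] by (intro alt_cong) auto
qed

end

section \<open>Embedding rings with carrier into a type-class ring\<close>

text \<open>There is no condition on units, as the target class has none.\<close>

definition class_hom :: "('a, 'b) ring_scheme \<Rightarrow> ('a \<Rightarrow> 'r::ring) \<Rightarrow> bool" where
  "class_hom R \<theta> \<longleftrightarrow> (\<forall>a\<in>carrier R. \<forall>b\<in>carrier R. \<theta> (a \<oplus>\<^bsub>R\<^esub> b) = \<theta> a + \<theta> b \<and> \<theta> (a \<otimes>\<^bsub>R\<^esub> b) = \<theta> a * \<theta> b)"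

lemma class_hom_comp:
  assumes "f \<in> ring_hom R S" "class_hom S \<theta>"
  shows "class_hom R (\<lambda>a. \<theta> (f a))"
  using assms by (simp add: class_hom_def ring_hom_add ring_hom_mult ring_hom_closed)

context ring
begin

lemma class_hom_add:
  assumes "class_hom R \<theta>" "a \<in> carrier R" "b \<in> carrier R"
  shows "\<theta> (a \<oplus> b) = \<theta> a + \<theta> b"
  using assms by (simp add: class_hom_def)

lemma class_hom_mult:
  assumes "class_hom R \<theta>" "a \<in> carrier R" "b \<in> carrier R"
  shows "\<theta> (a \<otimes> b) = \<theta> a * \<theta> b"
  using assms by (simp add: class_hom_def)

lemma class_hom_zero:
  assumes "class_hom R \<theta>"
  shows "\<theta> \<zero> = 0"
  using class_hom_add[OF assms zero_closed zero_closed] by simp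

lemma class_hom_a_inv:
  assumes "class_hom R \<theta>" "a \<in> carrier R"
  shows "\<theta> (\<ominus> a) = - \<theta> a"
  using class_hom_add[OF assms(1), of "\<ominus> a" a] assms(2)
  by (simp add: class_hom_zero[OF assms(1)] l_neg eq_neg_iff_add_eq_0)

lemma class_hom_minus:
  assumes "class_hom R \<theta>" "a \<in> carrier R" "b \<in> carrier R"
  shows "\<theta> (a \<ominus> b) = \<theta> a - \<theta> b"
  using assms by (simp add: minus_eq class_hom_add class_hom_a_inv)

lemma class_hom_finsum:
  assumes "class_hom R \<theta>" "f \<in> K \<rightarrow> carrier R" "finite K"
  shows "\<theta> (\<Oplus>k\<in>K. f k) = (\<Sum>k\<in>K. \<theta> (f k))"
  using assms(3,2)
proof (induction K rule: finite_induct)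
  case empty
  then show ?case by (simp add: class_hom_zero[OF assms(1)])
next
  case (insert k K)
  then have "f \<in> K \<rightarrow> carrier R" "f k \<in> carrier R" by auto
  then show ?case
    using insert by (simp add: finsum_insert class_hom_add[OF assms(1)])
qed

end

text \<open>
  The product of all rings on a type is a (non-unital) type-class ring depending on no parameters.
  A single ring \<open>R\<close> embeds into it as the families supported at \<open>R\<close>, which makes the automation for
  type classes available for computations in \<open>R\<close>. The value \<^const>\<open>undefined\<close> at non-rings makes
  families with equal components equal.
\<close>

typedef (overloaded) ('a, 'b) ring_family =
  "{f :: ('a, 'b) ring_scheme \<Rightarrow> 'a. \<forall>R. (ring R \<longrightarrow> f R \<in> carrier R) \<and> (\<not> ring R \<longrightarrow> f R = undefined)}"
  by (rule exI[of _ "\<lambda>R. if ring R then \<zero>\<^bsub>R\<^esub> else undefined"]) (auto intro: ring.ring_simprules)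

setup_lifting type_definition_ring_family

instantiation ring_family :: (type, type) ring
begin

lift_definition zero_ring_family :: "('a, 'b) ring_family" is
  "\<lambda>R. if ring R then \<zero>\<^bsub>R\<^esub> else undefined"
  by (auto intro: ring.ring_simprules)

lift_definition plus_ring_family :: "('a, 'b) ring_family \<Rightarrow> ('a, 'b) ring_family \<Rightarrow> ('a, 'b) ring_family" is
  "\<lambda>f g R. if ring R then f R \<oplus>\<^bsub>R\<^esub> g R else undefined"
  by (auto intro: ring.ring_simprules)

lift_definition uminus_ring_family :: "('a, 'b) ring_family \<Rightarrow> ('a, 'b) ring_family" is
  "\<lambda>f R. if ring R then \<ominus>\<^bsub>R\<^esub> f R else undefined"
  by (auto intro: ring.ring_simprules)

lift_definition minus_ring_family :: "('a, 'b) ring_family \<Rightarrow> ('a, 'b) ring_family \<Rightarrow> ('a, 'b) ring_family" is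
  "\<lambda>f g R. if ring R then f R \<ominus>\<^bsub>R\<^esub> g R else undefined"
  by (auto intro: ring.ring_simprules)

lift_definition times_ring_family :: "('a, 'b) ring_family \<Rightarrow> ('a, 'b) ring_family \<Rightarrow> ('a, 'b) ring_family" is
  "\<lambda>f g R. if ring R then f R \<otimes>\<^bsub>R\<^esub> g R else undefined"
  by (auto intro: ring.ring_simprules)

instance
proof
  fix a b c :: "('a, 'b) ring_family"
  show "a + b + c = a + (b + c)" "a + b = b + a" "0 + a = a" "- a + a = 0" "a - b = a + - b"
    "a * b * c = a * (b * c)" "(a + b) * c = a * c + b * c" "a * (b + c) = a * b + a * c"
    by (transfer; force simp: fun_eq_iff ring.ring_simprules)+
qed

end

text \<open>Elements outside the carrier go to the zero family, so the result lies in the type for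
  every argument.\<close>

lift_definition supported_at :: "('a, 'b) ring_scheme \<Rightarrow> 'a \<Rightarrow> ('a, 'b) ring_family" is
  "\<lambda>R a Q. if ring Q then if Q = R \<and> a \<in> carrier R then a else \<zero>\<^bsub>Q\<^esub> else undefined"
  by (auto intro: ring.ring_simprules)

context ring
begin

lemma class_hom_supported_at: "class_hom R (supported_at R)"
  unfolding class_hom_def
  by (transfer, auto simp: fun_eq_iff ring.ring_simprules)

lemma supported_at_inject:
  assumes "supported_at R a = supported_at R b" "a \<in> carrier R" "b \<in> carrier R"
  shows "a = b"
  using arg_cong[OF assms(1), of "\<lambda>f. Rep_ring_family f R"] assms(2,3) ring_axioms
  by (simp add: supported_at.rep_eq)

text \<open>In all components other than R both products are zero.\<close>

lemma supported_at_central: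
  assumes "a \<in> carrier R" "\<And>b. b \<in> carrier R \<Longrightarrow> a \<otimes> b = b \<otimes> a"
  shows "supported_at R a * y = y * supported_at R a"
  using assms by transfer (auto simp: fun_eq_iff ring.ring_simprules)

end

section \<open>Quotients of monoid algebras and tensor products\<close>

lemma monoid_algebra_single_central:
  assumes "monoid G" "Poly_Mapping.keys f \<subseteq> carrier G"
  shows "f \<otimes>\<^bsub>monoid_algebra G\<^esub> Poly_Mapping.single \<one>\<^bsub>G\<^esub> k =
    Poly_Mapping.single \<one>\<^bsub>G\<^esub> k \<otimes>\<^bsub>monoid_algebra G\<^esub> f"
proof -
  let ?s = "\<lambda>v. Poly_Mapping.single v (Poly_Mapping.lookup f v)"
  interpret monoid G by fact
  have "sum ?s (Poly_Mapping.keys f) \<otimes>\<^bsub>monoid_algebra G\<^esub> Poly_Mapping.single \<one>\<^bsub>G\<^esub> k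
    = Poly_Mapping.single \<one>\<^bsub>G\<^esub> k \<otimes>\<^bsub>monoid_algebra G\<^esub> sum ?s (Poly_Mapping.keys f)"
    unfolding monoid_algebra_sum_l monoid_algebra_sum_r monoid_algebra_mult_single
    using assms by (intro sum.cong refl) (auto simp: subset_iff mult.commute)
  then show ?thesis
    by (simp flip: poly_mapping_eq_sum_single)
qed

text \<open>The presented algebras and the tensor product are all quotients of monoid algebras;
  scalars are treated here once for all of them.\<close>

locale monoid_algebra_quotient =
  fixes G :: "('m, 'z) monoid_scheme" and I :: "('m \<Rightarrow>\<^sub>0 'k::comm_ring_1) set"
  assumes mon: "monoid G" and I: "ideal I (monoid_algebra G)"
begin

abbreviation "M \<equiv> monoid_algebra G :: ('k, 'm \<Rightarrow>\<^sub>0 'k) module"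
abbreviation "Q \<equiv> quotient_algebra M I"
abbreviation "cls f \<equiv> I +>\<^bsub>M\<^esub> f"

sublocale Q: ring Q
  by (rule quotient_algebra_ring[OF I])

lemma cls_hom: "cls \<in> ring_hom M Q"
  using ideal.rcos_ring_hom[OF I] by (simp add: quotient_algebra_def ring_hom_def)

sublocale cls: ring_hom_ring M Q cls
  by (intro ring_hom_ringI2 monoid_algebra_ring mon Q.ring_axioms cls_hom)

lemma cls_surj: "carrier Q = cls ` carrier M"
  by (auto simp: quotient_algebra_def FactRing_def A_RCOSETS_def')

lemma cls_smult:
  assumes "f \<in> carrier M" shows "k \<odot>\<^bsub>Q\<^esub> cls f = cls (k \<odot>\<^bsub>M\<^esub> f)"
  using assms by (intro quotient_monoid_algebra_smult mon I) simp

lemma one_carrier: "\<one>\<^bsub>G\<^esub> \<in> carrier G"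
  by (rule monoid.one_closed[OF mon])

lemma single_carrier: "g \<in> carrier G \<Longrightarrow> Poly_Mapping.single g k \<in> carrier M"
  by simp

lemma single_smult: "g \<in> carrier G \<Longrightarrow> k \<odot>\<^bsub>M\<^esub> Poly_Mapping.single g l = Poly_Mapping.single g (k * l)"
  by (subst monoid_algebra_smult[OF mon]) (simp_all add: monoid_algebra_mult_single monoid.l_one[OF mon])

lemma scalar: "k \<odot>\<^bsub>Q\<^esub> \<one>\<^bsub>Q\<^esub> = cls (Poly_Mapping.single \<one>\<^bsub>G\<^esub> k)"
  using cls_smult[of "\<one>\<^bsub>M\<^esub>" k] one_carrier by (simp add: cls.hom_one[symmetric] single_smult del: cls.hom_one)

lemma scalar_closed: "k \<odot>\<^bsub>Q\<^esub> \<one>\<^bsub>Q\<^esub> \<in> carrier Q"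
  unfolding scalar by (intro cls.hom_closed single_carrier one_carrier)

text \<open>In the monoid algebra a scalar acts as the monomial at the neutral element, and the
  class map is multiplicative.\<close>

lemma smult_eq_scalar:
  assumes "y \<in> carrier Q"
  shows "k \<odot>\<^bsub>Q\<^esub> y = (k \<odot>\<^bsub>Q\<^esub> \<one>\<^bsub>Q\<^esub>) \<otimes>\<^bsub>Q\<^esub> y"
proof -
  obtain f where f: "f \<in> carrier M" "y = cls f"
    using assms cls_surj by auto
  have "k \<odot>\<^bsub>M\<^esub> f = Poly_Mapping.single \<one>\<^bsub>G\<^esub> k \<otimes>\<^bsub>M\<^esub> f"
    using f(1) by (intro monoid_algebra_smult mon) simp
  then show ?thesis
    unfolding f(2) scalar cls_smult[OF f(1)]
    using cls.hom_mult[OF single_carrier[OF one_carrier] f(1)] by simp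
qed

lemma smult_closed: "y \<in> carrier Q \<Longrightarrow> k \<odot>\<^bsub>Q\<^esub> y \<in> carrier Q"
  by (simp only: smult_eq_scalar[of y] Q.m_closed scalar_closed)

lemma scalar_central:
  assumes "y \<in> carrier Q"
  shows "(k \<odot>\<^bsub>Q\<^esub> \<one>\<^bsub>Q\<^esub>) \<otimes>\<^bsub>Q\<^esub> y = y \<otimes>\<^bsub>Q\<^esub> (k \<odot>\<^bsub>Q\<^esub> \<one>\<^bsub>Q\<^esub>)"
proof -
  obtain f where f: "f \<in> carrier M" "y = cls f"
    using assms cls_surj by auto
  have "f \<otimes>\<^bsub>M\<^esub> Poly_Mapping.single \<one>\<^bsub>G\<^esub> k = Poly_Mapping.single \<one>\<^bsub>G\<^esub> k \<otimes>\<^bsub>M\<^esub> f"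
    using f(1) by (intro monoid_algebra_single_central mon) simp
  then show ?thesis
    unfolding f(2) scalar
    using cls.hom_mult[OF single_carrier[OF one_carrier] f(1)] cls.hom_mult[OF f(1) single_carrier[OF one_carrier]]
    by metis
qed

lemma scalar_one: "1 \<odot>\<^bsub>Q\<^esub> \<one>\<^bsub>Q\<^esub> = \<one>\<^bsub>Q\<^esub>"
  unfolding scalar using cls.hom_one by simp

lemma scalar_add: "(k + l) \<odot>\<^bsub>Q\<^esub> \<one>\<^bsub>Q\<^esub> = k \<odot>\<^bsub>Q\<^esub> \<one>\<^bsub>Q\<^esub> \<oplus>\<^bsub>Q\<^esub> l \<odot>\<^bsub>Q\<^esub> \<one>\<^bsub>Q\<^esub>"
  unfolding scalar single_add
  using cls.hom_add[OF single_carrier[OF one_carrier, of k] single_carrier[OF one_carrier, of l]] by simp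

lemma scalar_uminus: "(- k) \<odot>\<^bsub>Q\<^esub> \<one>\<^bsub>Q\<^esub> = \<ominus>\<^bsub>Q\<^esub> (k \<odot>\<^bsub>Q\<^esub> \<one>\<^bsub>Q\<^esub>)"
proof -
  have "(- k) \<odot>\<^bsub>Q\<^esub> \<one>\<^bsub>Q\<^esub> \<oplus>\<^bsub>Q\<^esub> k \<odot>\<^bsub>Q\<^esub> \<one>\<^bsub>Q\<^esub> = \<zero>\<^bsub>Q\<^esub>"
    unfolding scalar_add[symmetric] unfolding scalar using cls.hom_zero by simp
  then show ?thesis
    using Q.minus_equality[OF _ scalar_closed scalar_closed] by metis
qed

lemma cls_ideal: "r \<in> I \<Longrightarrow> cls r = \<zero>\<^bsub>Q\<^esub>"
  using ring.a_rcos_zero[OF monoid_algebra_ring[OF mon] I]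
  by (simp add: quotient_algebra_def FactRing_def)

end

section \<open>Algebras given by generators and relations\<close>

locale presentation =
  fixes G :: "'g set" and R :: "('g list \<Rightarrow>\<^sub>0 'k::comm_ring_1) set"
  assumes R: "R \<subseteq> carrier (free_algebra G)"
begin

sublocale monoid_algebra_quotient "free_monoid G" "Idl\<^bsub>free_algebra G\<^esub> R"
proof (rule monoid_algebra_quotient.intro)
  show "monoid (free_monoid G)"
    by (rule monoidI) (auto simp: free_monoid_def)
  show "ideal (Idl\<^bsub>free_algebra G\<^esub> R) (monoid_algebra (free_monoid G))"
    using ring.genideal_ideal[OF free_algebra_ring R] by (simp add: free_algebra_def)
qed

lemma presented_eq: "presented_algebra G R = Q"
  by (simp add: presented_algebra_def free_algebra_def)

lemma presented_gen_eq: "presented_gen G R g = cls (free_gen g)"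
  by (simp add: presented_gen_def free_algebra_def)

lemma cls_relation: "r \<in> R \<Longrightarrow> cls r = \<zero>\<^bsub>Q\<^esub>"
  using ring.genideal_self[OF free_algebra_ring R] by (intro cls_ideal) blast

lemma cls_closed: "f \<in> carrier (free_algebra G) \<Longrightarrow> cls f \<in> carrier Q"
  using cls.hom_closed[of f] by (simp add: free_algebra_def)

lemma cls_smult_free:
  "f \<in> carrier (free_algebra G) \<Longrightarrow> cls (k \<odot>\<^bsub>free_algebra G\<^esub> f) = k \<odot>\<^bsub>Q\<^esub> cls f"
  using cls_smult[of f k] by (simp add: free_algebra_def)

end

section \<open>Tensor products of algebras\<close>

locale tensor =
  fixes A :: "('k::comm_ring_1, 'a) module" and C :: "('k, 'c) module"
  assumes ring_A: "ring A" and ring_C: "ring C"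
    and smult_A: "\<And>k a. a \<in> carrier A \<Longrightarrow> k \<odot>\<^bsub>A\<^esub> a \<in> carrier A"
    and smult_C: "\<And>k c. c \<in> carrier C \<Longrightarrow> k \<odot>\<^bsub>C\<^esub> c \<in> carrier C"
begin

lemma relations_closed: "bilinear_relations A C \<subseteq> carrier (pair_algebra A C)"
  by (intro bilinear_relations_closed ring_A ring_C smult_A smult_C)

sublocale monoid_algebra_quotient "A \<times>\<times> C" "Idl\<^bsub>pair_algebra A C\<^esub> (bilinear_relations A C)"
proof (rule monoid_algebra_quotient.intro)
  show "monoid (A \<times>\<times> C)"
    by (intro DirProd_monoid ring.is_monoid ring_A ring_C)
  show "ideal (Idl\<^bsub>pair_algebra A C\<^esub> (bilinear_relations A C)) (monoid_algebra (A \<times>\<times> C))"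
    using ring.genideal_ideal[OF pair_algebra_ring[OF ring_A ring_C] relations_closed]
    by (simp add: pair_algebra_def)
qed

sublocale A: ring A by (rule ring_A)
sublocale C: ring C by (rule ring_C)

lemma tensor_eq: "tensor_algebra A C = Q"
  by (simp add: tensor_algebra_def pair_algebra_def)

abbreviation pure :: "'a \<Rightarrow> 'c \<Rightarrow> ('a \<times> 'c \<Rightarrow>\<^sub>0 'k) set" where
  "pure \<equiv> pure_tensor A C"

lemma pure_eq: "pure a c = cls (Poly_Mapping.single (a, c) 1)"
  by (simp add: pure_tensor_def pair_algebra_def)

lemma pure_carrier: "a \<in> carrier A \<Longrightarrow> c \<in> carrier C \<Longrightarrow> Poly_Mapping.single (a, c) k \<in> carrier M"
  by simp

lemma pure_closed: "a \<in> carrier A \<Longrightarrow> c \<in> carrier C \<Longrightarrow> pure a c \<in> carrier Q"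
  unfolding pure_eq by (intro cls.hom_closed pure_carrier)

lemma pure_one: "pure \<one>\<^bsub>A\<^esub> \<one>\<^bsub>C\<^esub> = \<one>\<^bsub>Q\<^esub>"
  using cls.hom_one by (simp add: pure_eq)

lemma pure_mult:
  assumes "a \<in> carrier A" "a' \<in> carrier A" "c \<in> carrier C" "c' \<in> carrier C"
  shows "pure a c \<otimes>\<^bsub>Q\<^esub> pure a' c' = pure (a \<otimes>\<^bsub>A\<^esub> a') (c \<otimes>\<^bsub>C\<^esub> c')"
  using cls.hom_mult[OF pure_carrier[OF assms(1,3), of 1] pure_carrier[OF assms(2,4), of 1]]
  by (simp add: pure_eq monoid_algebra_mult_single)

text \<open>The class of f - g is zero; adding the class of g gives the claim.\<close>

lemma relation_eq:
  assumes "f - g \<in> bilinear_relations A C" "g \<in> carrier M"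
  shows "cls f = cls g"
proof -
  have fg: "f - g \<in> carrier M"
    using assms(1) relations_closed by (auto simp: pair_algebra_def)
  have "cls (f - g) = \<zero>\<^bsub>Q\<^esub>"
    using ring.genideal_self[OF pair_algebra_ring[OF ring_A ring_C] relations_closed] assms(1)
    by (intro cls_ideal) blast
  then have "cls ((f - g) + g) = cls g"
    using cls.hom_add[OF fg assms(2)] cls.hom_closed[OF assms(2)] by simp
  then show ?thesis by simp
qed

lemma pure_add_left:
  assumes "a \<in> carrier A" "a' \<in> carrier A" "c \<in> carrier C"
  shows "pure (a \<oplus>\<^bsub>A\<^esub> a') c = pure a c \<oplus>\<^bsub>Q\<^esub> pure a' c"
proof -
  let ?s = "\<lambda>a. Poly_Mapping.single (a, c) (1::'k)"
  have "cls (?s (a \<oplus>\<^bsub>A\<^esub> a')) = cls (?s a + ?s a')"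
  proof (rule relation_eq)
    show "?s (a \<oplus>\<^bsub>A\<^esub> a') - (?s a + ?s a') \<in> bilinear_relations A C"
      using assms unfolding bilinear_relations_def diff_diff_eq[symmetric] by blast
    show "?s a + ?s a' \<in> carrier M"
      using cls.R.a_closed[OF pure_carrier[OF assms(1,3)] pure_carrier[OF assms(2,3)]] by simp
  qed
  then show ?thesis
    using cls.hom_add[OF pure_carrier[OF assms(1,3), of 1] pure_carrier[OF assms(2,3), of 1]]
    by (simp add: pure_eq)
qed

lemma pure_add_right:
  assumes "a \<in> carrier A" "c \<in> carrier C" "c' \<in> carrier C"
  shows "pure a (c \<oplus>\<^bsub>C\<^esub> c') = pure a c \<oplus>\<^bsub>Q\<^esub> pure a c'"
proof -
  let ?s = "\<lambda>c. Poly_Mapping.single (a, c) (1::'k)"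
  have "cls (?s (c \<oplus>\<^bsub>C\<^esub> c')) = cls (?s c + ?s c')"
  proof (rule relation_eq)
    show "?s (c \<oplus>\<^bsub>C\<^esub> c') - (?s c + ?s c') \<in> bilinear_relations A C"
      using assms unfolding bilinear_relations_def diff_diff_eq[symmetric] by blast
    show "?s c + ?s c' \<in> carrier M"
      using cls.R.a_closed[OF pure_carrier[OF assms(1,2)] pure_carrier[OF assms(1,3)]] by simp
  qed
  then show ?thesis
    using cls.hom_add[OF pure_carrier[OF assms(1,2), of 1] pure_carrier[OF assms(1,3), of 1]]
    by (simp add: pure_eq)
qed

lemma smult_pure:
  assumes "a \<in> carrier A" "c \<in> carrier C"
  shows "k \<odot>\<^bsub>Q\<^esub> pure a c = cls (Poly_Mapping.single (a, c) k)"
  using assms cls_smult[OF pure_carrier[OF assms]] by (simp add: pure_eq single_smult)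

lemma pure_smult_left:
  assumes "a \<in> carrier A" "c \<in> carrier C"
  shows "pure (k \<odot>\<^bsub>A\<^esub> a) c = k \<odot>\<^bsub>Q\<^esub> pure a c"
  unfolding smult_pure[OF assms] unfolding pure_eq
  by (rule relation_eq[OF _ pure_carrier[OF assms]]) (use assms in \<open>unfold bilinear_relations_def, blast\<close>)

lemma pure_smult_right:
  assumes "a \<in> carrier A" "c \<in> carrier C"
  shows "pure a (k \<odot>\<^bsub>C\<^esub> c) = k \<odot>\<^bsub>Q\<^esub> pure a c"
  unfolding smult_pure[OF assms] unfolding pure_eq
  by (rule relation_eq[OF _ pure_carrier[OF assms]]) (use assms in \<open>unfold bilinear_relations_def, blast\<close>)

lemma pure_left_hom: "(\<lambda>a. pure a \<one>\<^bsub>C\<^esub>) \<in> ring_hom A Q"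
  by (rule ring_hom_memI) (simp_all add: pure_closed pure_mult pure_add_left pure_one)

lemma pure_right_hom: "(\<lambda>c. pure \<one>\<^bsub>A\<^esub> c) \<in> ring_hom C Q"
  by (rule ring_hom_memI) (simp_all add: pure_closed pure_mult pure_add_right pure_one)

lemma pure_commute:
  assumes "a \<in> carrier A" "c \<in> carrier C"
  shows "pure \<one>\<^bsub>A\<^esub> c \<otimes>\<^bsub>Q\<^esub> pure a \<one>\<^bsub>C\<^esub> = pure a \<one>\<^bsub>C\<^esub> \<otimes>\<^bsub>Q\<^esub> pure \<one>\<^bsub>A\<^esub> c"
  using assms by (simp add: pure_mult)

end

section \<open>The algebra \<open>A \<otimes> C\<close>\<close>

locale AC_signed =
  fixes N :: nat and \<epsilon> :: "'k::real_normed_field"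
  assumes sign: "\<epsilon> = 1 \<or> \<epsilon> = -1"
begin

declare One_nat_def [simp del]

sublocale XP: presentation "xp_gens N" "xp_relations N :: (xp list \<Rightarrow>\<^sub>0 'k) set"
  by unfold_locales (rule xp_relations_closed)

sublocale CL: presentation "{1..N}" "clifford_relations N \<epsilon>"
  by unfold_locales (rule clifford_relations_closed)

sublocale T: tensor XP.Q CL.Q
  by (rule tensor.intro) (rule XP.Q.ring_axioms CL.Q.ring_axioms XP.smult_closed CL.smult_closed; assumption?)+

abbreviation "R \<equiv> AC N \<epsilon>"
abbreviation "emb \<equiv> supported_at R"
abbreviation "scalar k \<equiv> emb (k \<odot>\<^bsub>R\<^esub> \<one>\<^bsub>R\<^esub>)"

lemma xp_eq: "xp_algebra N = XP.Q"
  by (simp add: xp_algebra_def XP.presented_eq)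

lemma clifford_eq: "clifford_algebra N \<epsilon> = CL.Q"
  by (simp add: clifford_algebra_def CL.presented_eq)

lemma AC_eq: "R = T.Q"
  by (simp add: AC_def xp_eq clifford_eq T.tensor_eq)

sublocale R: ring R
  by (rule AC_ring)

lemma emb_hom: "class_hom R emb"
  by (rule R.class_hom_supported_at)

lemma scalar_closed: "k \<odot>\<^bsub>R\<^esub> \<one>\<^bsub>R\<^esub> \<in> carrier R"
  unfolding AC_eq by (rule T.scalar_closed)

lemma smult_closed: "y \<in> carrier R \<Longrightarrow> k \<odot>\<^bsub>R\<^esub> y \<in> carrier R"
  unfolding AC_eq by (rule T.smult_closed)

lemma emb_smult: "y \<in> carrier R \<Longrightarrow> emb (k \<odot>\<^bsub>R\<^esub> y) = scalar k * emb y"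
  using T.smult_eq_scalar[of y k, folded AC_eq] R.class_hom_mult[OF emb_hom scalar_closed] by simp

lemma scalar_central: "scalar k * y = y * scalar k"
  by (rule R.supported_at_central[OF scalar_closed]) (unfold AC_eq, rule T.scalar_central)

lemma scalar_left_commute: "v * (scalar k * y) = scalar k * (v * y)"
  by (simp only: scalar_central[of k v] flip: mult.assoc)

lemma scalar_one: "scalar 1 = emb \<one>\<^bsub>R\<^esub>"
  using T.scalar_one by (simp add: AC_eq)

lemma scalar_uminus: "scalar (- k) = - scalar k"
  using T.scalar_uminus R.class_hom_a_inv[OF emb_hom scalar_closed] by (simp add: AC_eq)

lemma scalar_add: "scalar (k + l) = scalar k + scalar l"
  using T.scalar_add R.class_hom_add[OF emb_hom scalar_closed scalar_closed] by (simp add: AC_eq)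

lemma emb_one:
  assumes "y \<in> carrier R" shows "emb \<one>\<^bsub>R\<^esub> * emb y = emb y"
  using R.class_hom_mult[OF emb_hom R.one_closed assms] assms by simp

text \<open>Class map, tensor factor inclusion and embedding in one homomorphism, under which each
  defining relation becomes an equation in the type-class ring.\<close>

definition xp_map :: "(xp list \<Rightarrow>\<^sub>0 'k) \<Rightarrow> ('k AC, _) ring_family" where
  "xp_map f = emb (T.pure (XP.cls f) \<one>\<^bsub>CL.Q\<^esub>)"

definition clifford_map :: "(nat list \<Rightarrow>\<^sub>0 'k) \<Rightarrow> ('k AC, _) ring_family" where
  "clifford_map f = emb (T.pure \<one>\<^bsub>XP.Q\<^esub> (CL.cls f))"

lemma pure_left_emb: "class_hom XP.Q (\<lambda>a. emb (T.pure a \<one>\<^bsub>CL.Q\<^esub>))"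
  using class_hom_comp[OF T.pure_left_hom emb_hom[unfolded AC_eq]] by (simp add: AC_eq)

lemma pure_right_emb: "class_hom CL.Q (\<lambda>c. emb (T.pure \<one>\<^bsub>XP.Q\<^esub> c))"
  using class_hom_comp[OF T.pure_right_hom emb_hom[unfolded AC_eq]] by (simp add: AC_eq)

lemma xp_map_hom: "class_hom (free_algebra (xp_gens N)) xp_map"
  using class_hom_comp[OF XP.cls_hom pure_left_emb] unfolding xp_map_def free_algebra_def .

lemma clifford_map_hom: "class_hom (free_algebra {1..N}) clifford_map"
  using class_hom_comp[OF CL.cls_hom pure_right_emb] unfolding clifford_map_def free_algebra_def .

lemma xp_map_relation: "r \<in> xp_relations N \<Longrightarrow> xp_map r = 0"
  using XP.Q.class_hom_zero[OF pure_left_emb] by (simp add: xp_map_def XP.cls_relation)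

lemma clifford_map_relation: "r \<in> clifford_relations N \<epsilon> \<Longrightarrow> clifford_map r = 0"
  using CL.Q.class_hom_zero[OF pure_right_emb] by (simp add: clifford_map_def CL.cls_relation)

lemma xp_map_smult:
  assumes "f \<in> carrier (free_algebra (xp_gens N))"
  shows "xp_map (k \<odot>\<^bsub>free_algebra (xp_gens N)\<^esub> f) = scalar k * xp_map f"
proof -
  have f: "XP.cls f \<in> carrier XP.Q"
    by (rule XP.cls_closed[OF assms])
  show ?thesis
    unfolding xp_map_def XP.cls_smult_free[OF assms] T.pure_smult_left[OF f CL.Q.one_closed, folded AC_eq]
    by (rule emb_smult[OF T.pure_closed[OF f CL.Q.one_closed, folded AC_eq]])
qed

lemma clifford_map_smult:
  assumes "f \<in> carrier (free_algebra {1..N})"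
  shows "clifford_map (k \<odot>\<^bsub>free_algebra {1..N}\<^esub> f) = scalar k * clifford_map f"
proof -
  have f: "CL.cls f \<in> carrier CL.Q"
    by (rule CL.cls_closed[OF assms])
  show ?thesis
    unfolding clifford_map_def CL.cls_smult_free[OF assms] T.pure_smult_right[OF XP.Q.one_closed f, folded AC_eq]
    by (rule emb_smult[OF T.pure_closed[OF XP.Q.one_closed f, folded AC_eq]])
qed

lemma xp_map_clifford_map:
  assumes "f \<in> carrier (free_algebra (xp_gens N))" "g \<in> carrier (free_algebra {1..N})"
  shows "clifford_map g * xp_map f = xp_map f * clifford_map g"
proof -
  have f: "XP.cls f \<in> carrier XP.Q" and g: "CL.cls g \<in> carrier CL.Q"
    by (rule XP.cls_closed[OF assms(1)], rule CL.cls_closed[OF assms(2)])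
  note pure_closed = T.pure_closed[OF f CL.Q.one_closed, folded AC_eq]
    T.pure_closed[OF XP.Q.one_closed g, folded AC_eq]
  show ?thesis
    unfolding xp_map_def clifford_map_def R.class_hom_mult[OF emb_hom pure_closed, symmetric]
      R.class_hom_mult[OF emb_hom pure_closed(2,1), symmetric] T.pure_commute[OF f g, folded AC_eq] ..
qed

abbreviation "x i \<equiv> emb (x_el N \<epsilon> i)"
abbreviation "p i \<equiv> emb (p_el N \<epsilon> i)"
abbreviation "e i \<equiv> emb (e_el N \<epsilon> i)"

lemma gens: "x i = xp_map (free_gen (X i))" "p i = xp_map (free_gen (P i))" "e i = clifford_map (free_gen i)"
  by (simp_all add: x_el_def p_el_def e_el_def xp_map_def clifford_map_def xp_eq clifford_eq
      XP.presented_gen_eq CL.presented_gen_eq)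

lemma gens_closed:
  assumes "i \<in> {1..N}"
  shows "x_el N \<epsilon> i \<in> carrier R" "p_el N \<epsilon> i \<in> carrier R" "e_el N \<epsilon> i \<in> carrier R"
  unfolding x_el_def p_el_def e_el_def xp_eq clifford_eq AC_eq XP.presented_gen_eq CL.presented_gen_eq
  by (intro T.pure_closed XP.cls_closed CL.cls_closed XP.Q.one_closed CL.Q.one_closed xp_gens_closed
      free_gen_closed assms)+

text \<open>The assumptions are images of defining relations, facts on scalars, or the commutation
  of the two tensor factors.\<close>

sublocale xp_clifford N x p e "emb \<one>\<^bsub>R\<^esub>" "scalar (1/2)" "scalar \<epsilon>"
proof (rule xp_clifford.intro)
  interpret F: ring "free_algebra (xp_gens N) :: ('k, _) module" by (rule free_algebra_ring)
  interpret G: ring "free_algebra {1..N} :: ('k, _) module" by (rule free_algebra_ring)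
  note F_simps = F.class_hom_add[OF xp_map_hom] F.class_hom_mult[OF xp_map_hom]
    F.class_hom_minus[OF xp_map_hom] F.class_hom_finsum[OF xp_map_hom] xp_map_smult
    xp_gens_closed free_algebra_smult_closed Pi_iff
  note G_simps = G.class_hom_add[OF clifford_map_hom] G.class_hom_mult[OF clifford_map_hom]
    G.class_hom_minus[OF clifford_map_hom] clifford_map_smult free_gen_closed free_algebra_smult_closed
  have one: "\<one>\<^bsub>free_algebra {1..N}\<^esub> = \<one>\<^bsub>CL.M\<^esub>"
    by (simp only: free_algebra_def)
  have clifford_one: "clifford_map \<one>\<^bsub>free_algebra {1..N}\<^esub> = scalar 1"
    unfolding clifford_map_def one CL.cls.hom_one T.pure_one scalar_one unfolding AC_eq ..
  show "emb \<one>\<^bsub>R\<^esub> * y = y * emb \<one>\<^bsub>R\<^esub>" for y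
    using scalar_central[of 1] by (simp add: scalar_one)
  show "scalar (1/2) * y = y * scalar (1/2)" "scalar \<epsilon> * y = y * scalar \<epsilon>" for y
    by (rule scalar_central)+
  show "emb \<one>\<^bsub>R\<^esub> * emb \<one>\<^bsub>R\<^esub> = emb \<one>\<^bsub>R\<^esub>"
    by (rule emb_one) simp
  show "scalar (1/2) + scalar (1/2) = emb \<one>\<^bsub>R\<^esub>"
    using scalar_add[of "1/2" "1/2"] scalar_one by simp
  show "scalar \<epsilon> = emb \<one>\<^bsub>R\<^esub> \<or> scalar \<epsilon> = - emb \<one>\<^bsub>R\<^esub>"
    using sign scalar_one scalar_uminus[of 1] by auto
  fix i assume i: "i \<in> {1..N}"
  show "emb \<one>\<^bsub>R\<^esub> * x i = x i" "emb \<one>\<^bsub>R\<^esub> * p i = p i" "emb \<one>\<^bsub>R\<^esub> * e i = e i"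
    by (intro emb_one gens_closed i)+
  let ?F = "free_algebra (xp_gens N) :: ('k, _) module"
  let ?x = "\<lambda>i. free_gen (X i) :: xp list \<Rightarrow>\<^sub>0 'k" and ?p = "\<lambda>i. free_gen (P i) :: xp list \<Rightarrow>\<^sub>0 'k"
  have "commutator ?F ((1/2) \<odot>\<^bsub>?F\<^esub> (\<Oplus>\<^bsub>?F\<^esub>i\<in>{1..N}. ?p i \<otimes>\<^bsub>?F\<^esub> ?p i)) (?x i) \<ominus>\<^bsub>?F\<^esub> ?p i \<in> xp_relations N"
    unfolding xp_relations_def Let_def using i by blast
  from xp_map_relation[OF this]
  show "scalar (1/2) * (\<Sum>j\<in>{1..N}. p j * p j) * x i - x i * (scalar (1/2) * (\<Sum>j\<in>{1..N}. p j * p j)) = p i"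
    using i unfolding commutator_def gens by (simp add: F_simps)
  have "commutator ?F ((1/2) \<odot>\<^bsub>?F\<^esub> (\<Oplus>\<^bsub>?F\<^esub>i\<in>{1..N}. ?x i \<otimes>\<^bsub>?F\<^esub> ?x i)) (?p i) \<oplus>\<^bsub>?F\<^esub> ?x i \<in> xp_relations N"
    unfolding xp_relations_def Let_def using i by blast
  from xp_map_relation[OF this]
  show "scalar (1/2) * (\<Sum>j\<in>{1..N}. x j * x j) * p i - p i * (scalar (1/2) * (\<Sum>j\<in>{1..N}. x j * x j)) = - x i"
    using i unfolding commutator_def gens by (simp add: F_simps eq_neg_iff_add_eq_0)
  fix j assume j: "j \<in> {1..N}"
  have "commutator ?F (?x i) (?x j) \<in> xp_relations N" "commutator ?F (?p i) (?p j) \<in> xp_relations N"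
    unfolding xp_relations_def Let_def using i j by blast+
  from this[THEN xp_map_relation] show "x i * x j = x j * x i" "p i * p j = p j * p i"
    using i j unfolding commutator_def gens by (simp_all add: F_simps)
  show "e i * x j = x j * e i" "e i * p j = p j * e i"
    unfolding gens by (intro xp_map_clifford_map xp_gens_closed free_gen_closed i j)+
  let ?G = "free_algebra {1..N} :: ('k, _) module" and ?e = "free_gen :: nat \<Rightarrow> nat list \<Rightarrow>\<^sub>0 'k"
  have "(?e i \<otimes>\<^bsub>?G\<^esub> ?e j \<oplus>\<^bsub>?G\<^esub> ?e j \<otimes>\<^bsub>?G\<^esub> ?e i) \<ominus>\<^bsub>?G\<^esub>
      ((2 * \<epsilon> * (if i = j then 1 else 0)) \<odot>\<^bsub>?G\<^esub> \<one>\<^bsub>?G\<^esub>) \<in> clifford_relations N \<epsilon>"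
    unfolding clifford_relations_def Let_def using i j by blast
  from clifford_map_relation[OF this]
  have "e i * e j + e j * e i = scalar (2 * \<epsilon> * (if i = j then 1 else 0)) * scalar 1"
    using i j unfolding gens by (simp add: G_simps clifford_one)
  also have "\<dots> = scalar (2 * \<epsilon> * (if i = j then 1 else 0))"
    using emb_one[OF scalar_closed] by (simp only: scalar_one scalar_central)
  \<comment> \<open>Additivity at 0 + 0 forces \<open>scalar 0 = 0\<close>, which settles distinct
    indices.\<close>
  also have "\<dots> = (if i = j then scalar \<epsilon> + scalar \<epsilon> else 0)"
    using scalar_add[of \<epsilon> \<epsilon>] scalar_add[of 0 0] by simp
  finally show "e i * e j + e j * e i = (if i = j then scalar \<epsilon> + scalar \<epsilon> else 0)" .
qed

section \<open>The operators and supercommutators under the embedding\<close>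

lemma D_closed: "D_el N \<epsilon> \<in> carrier R"
  unfolding D_el_def by (intro R.finsum_closed Pi_I R.m_closed gens_closed)

text \<open>In \<open>cvec\<close> the factors stand in the opposite order; \<open>e i\<close> and
  \<open>p i\<close> commute.\<close>

lemma emb_D: "emb (D_el N \<epsilon>) = cvec p {1..N}"
proof -
  have "emb (D_el N \<epsilon>) = (\<Sum>i\<in>{1..N}. emb (e_el N \<epsilon> i \<otimes>\<^bsub>R\<^esub> p_el N \<epsilon> i))"
    unfolding D_el_def by (intro R.class_hom_finsum emb_hom Pi_I R.m_closed gens_closed) auto
  also have "\<dots> = cvec p {1..N}"
    unfolding cvec_def by (intro sum.cong refl)
      (simp only: R.class_hom_mult[OF emb_hom] gens_closed ep)
  finally show ?thesis .
qed

lemma x_vec_closed: "S \<subseteq> {1..N} \<Longrightarrow> x_vec N \<epsilon> S \<in> carrier R"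
  unfolding x_vec_def by (intro R.finsum_closed Pi_I R.m_closed gens_closed) auto

lemma emb_x_vec:
  assumes "S \<subseteq> {1..N}"
  shows "emb (x_vec N \<epsilon> S) = cvec x S"
proof -
  have "emb (x_vec N \<epsilon> S) = (\<Sum>i\<in>S. emb (x_el N \<epsilon> i \<otimes>\<^bsub>R\<^esub> e_el N \<epsilon> i))"
    unfolding x_vec_def using assms finite_subset[OF assms]
    by (intro R.class_hom_finsum emb_hom Pi_I R.m_closed gens_closed) auto
  also have "\<dots> = cvec x S"
    unfolding cvec_def using assms
    by (intro sum.cong refl R.class_hom_mult[OF emb_hom] gens_closed) auto
  finally show ?thesis .
qed

lemma alg_prod_list_closed: "set ys \<subseteq> carrier R \<Longrightarrow> alg_prod_list R ys \<in> carrier R"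
  by (induction ys) (auto simp: alg_prod_list_def)

lemma emb_alg_prod_list:
  "set ys \<subseteq> carrier R \<Longrightarrow> emb (alg_prod_list R ys) = foldr (*) (map emb ys) (emb \<one>\<^bsub>R\<^esub>)"
proof (induction ys)
  case (Cons y ys)
  then have "emb (y \<otimes>\<^bsub>R\<^esub> alg_prod_list R ys) = emb y * emb (alg_prod_list R ys)"
    by (intro R.class_hom_mult[OF emb_hom] alg_prod_list_closed) auto
  with Cons show ?case
    by (simp add: alg_prod_list_def)
qed (simp add: alg_prod_list_def)

lemma e_list_closed: "set A \<subseteq> {1..N} \<Longrightarrow> e_list N \<epsilon> A \<in> carrier R"
  unfolding e_list_def by (rule alg_prod_list_closed) (auto intro: gens_closed)

lemma emb_e_list:
  assumes "set A \<subseteq> {1..N}" shows "emb (e_list N \<epsilon> A) = e_prod A"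
proof -
  have "set (map (e_el N \<epsilon>) A) \<subseteq> carrier R"
    using assms by (auto intro: gens_closed)
  then show ?thesis
    unfolding e_list_def e_prod_def by (simp add: emb_alg_prod_list comp_def)
qed

definition E_prod :: "nat list list \<Rightarrow> ('k AC, _) ring_family" where
  "E_prod As = foldr (*) (map e_prod As) (emb \<one>\<^bsub>R\<^esub>)"

lemma index_set_subset: "\<forall>A\<in>set As. set A \<subseteq> {1..N} \<Longrightarrow> index_set As \<subseteq> {1..N}"
  by (induction As) (auto simp: index_set_def)

lemma O_el_emb:
  assumes As: "\<forall>A\<in>set As. set A \<subseteq> {1..N}"
  shows "O_el N \<epsilon> As \<in> carrier R" "emb (O_el N \<epsilon> As) = scalar (1/2) * Op (index_set As) (E_prod As)"
proof -
  define E xS D where "E = alg_prod_list R (map (e_list N \<epsilon>) As)"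
    and "xS = x_vec N \<epsilon> (index_set As)" and "D = D_el N \<epsilon>"
  have *: "set (map (e_list N \<epsilon>) As) \<subseteq> carrier R"
    using As by (auto intro: e_list_closed)
  have E: "E \<in> carrier R" "emb E = E_prod As"
    using alg_prod_list_closed[OF *] emb_alg_prod_list[OF *] As
    by (auto simp: E_def E_prod_def comp_def emb_e_list cong: map_cong)
  have xS: "xS \<in> carrier R" "emb xS = cvec x (index_set As)"
    unfolding xS_def using index_set_subset[OF As] by (simp_all only: x_vec_closed emb_x_vec)
  have D: "D \<in> carrier R" "emb D = cvec p {1..N}"
    unfolding D_def by (rule D_closed, rule emb_D)
  have O: "O_el N \<epsilon> As =
      (1/2) \<odot>\<^bsub>R\<^esub> ((D \<otimes>\<^bsub>R\<^esub> xS \<otimes>\<^bsub>R\<^esub> E \<ominus>\<^bsub>R\<^esub> E \<otimes>\<^bsub>R\<^esub> xS \<otimes>\<^bsub>R\<^esub> D) \<ominus>\<^bsub>R\<^esub> \<epsilon> \<odot>\<^bsub>R\<^esub> E)"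
    by (simp add: O_el_def Let_def E_def xS_def D_def)
  note closed = R.minus_closed R.m_closed smult_closed E(1) xS(1) D(1)
  show "O_el N \<epsilon> As \<in> carrier R"
    unfolding O by (intro closed)
  show "emb (O_el N \<epsilon> As) = scalar (1/2) * Op (index_set As) (E_prod As)"
    unfolding O Op_def
    by (simp only: R.class_hom_minus[OF emb_hom] R.class_hom_mult[OF emb_hom] emb_smult closed E(2) xS(2) D(2))
qed

text \<open>The image of the unit stays as a factor, since it is known to act as identity only on
  embedded elements.\<close>

lemma scalar_sign: "scalar ((- 1) ^ n) * y = alt n (emb \<one>\<^bsub>R\<^esub> * y)"
  using scalar_uminus[of 1] by (cases "even n") (simp_all add: alt_def scalar_one)

lemma O_supercomm_emb:
  assumes As: "\<forall>A\<in>set As. set A \<subseteq> {1..N}" and Bs: "\<forall>B\<in>set Bs. set B \<subseteq> {1..N}"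
  defines "S \<equiv> index_set As" and "T \<equiv> index_set Bs"
  shows "O_supercomm N \<epsilon> As Bs \<in> carrier R"
    "emb (O_supercomm N \<epsilon> As Bs) = scalar (1/2) * (scalar (1/2) *
      (Op S (E_prod As) * Op T (E_prod Bs)
        - alt (card S * card T - card (S \<inter> T)) (Op T (E_prod Bs) * Op S (E_prod As))))"
proof -
  note A = O_el_emb[OF As] and B = O_el_emb[OF Bs]
  let ?n = "card S * card T - card (S \<inter> T)"
  have def: "O_supercomm N \<epsilon> As Bs = (O_el N \<epsilon> As \<otimes>\<^bsub>R\<^esub> O_el N \<epsilon> Bs)
    \<ominus>\<^bsub>R\<^esub> ((-1) ^ ?n) \<odot>\<^bsub>R\<^esub> (O_el N \<epsilon> Bs \<otimes>\<^bsub>R\<^esub> O_el N \<epsilon> As)"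
    by (simp add: O_supercomm_def Let_def S_def T_def)
  note closed = R.minus_closed R.m_closed smult_closed A(1) B(1)
  show "O_supercomm N \<epsilon> As Bs \<in> carrier R"
    unfolding def by (intro closed)
  have half: "scalar (1/2) * v * (scalar (1/2) * w) = scalar (1/2) * (scalar (1/2) * (v * w))" for v w
    unfolding mult.assoc scalar_left_commute[of v] ..
  note BA = emb_one[OF R.m_closed[OF B(1) A(1)], unfolded R.class_hom_mult[OF emb_hom B(1) A(1)]]
  have "emb (O_supercomm N \<epsilon> As Bs)
    = emb (O_el N \<epsilon> As) * emb (O_el N \<epsilon> Bs) - alt ?n (emb (O_el N \<epsilon> Bs) * emb (O_el N \<epsilon> As))"
    unfolding def by (simp only: R.class_hom_minus[OF emb_hom] emb_smult scalar_sign BA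
        R.class_hom_mult[OF emb_hom] closed)
  then show "emb (O_supercomm N \<epsilon> As Bs) = scalar (1/2) * (scalar (1/2) *
      (Op S (E_prod As) * Op T (E_prod Bs)
        - alt ?n (Op T (E_prod Bs) * Op S (E_prod As))))"
    unfolding A(2) B(2) half S_def[symmetric] T_def[symmetric]
    by (simp only: right_diff_distrib alt_mult)
qed

lemma E_prod_simps:
  "E_prod [] = emb \<one>\<^bsub>R\<^esub>" "E_prod (A # As) = e_prod A * E_prod As"
  by (simp_all add: E_prod_def)

text \<open>The embedding is injective on the carrier, so it suffices to compare images, where
  \<open>Op_bracket_subset\<close> applies with the sign from \<open>e_prod_swap\<close>.\<close>

lemma O_supercomm_subset:
  assumes A: "distinct A" "set A \<subseteq> {1..N}" and B: "distinct B" "set B \<subseteq> {1..N}"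
    and AB: "set A \<subseteq> set B"
  shows "O_supercomm N \<epsilon> [A] [B] =
    \<epsilon> \<odot>\<^bsub>R\<^esub> (\<Oplus>\<^bsub>R\<^esub>a\<in>set A. O_supercomm N \<epsilon> [[a]] [[a], A, B])"
proof (rule R.supported_at_inject)
  let ?h = "scalar (1/2)" and ?c = "scalar \<epsilon>"
  let ?T = "\<lambda>a. insert a (set B - set A)" and ?G = "\<lambda>a. e a * (e_prod A * e_prod B)"
  let ?br = "\<lambda>a. Op {a} (e a) * Op (?T a) (?G a) - alt (card (?T a) + 1) (Op (?T a) (?G a) * Op {a} (e a))"
  have right_unit: "y * emb \<one>\<^bsub>R\<^esub> = y" if "clifford S y" for S y
    using that u_central[of y] by (simp add: clifford_def)
  note cA = clifford_e_prod[OF A] and cB = clifford_e_prod[OF B]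
  have index: "index_set [C] = set C" for C
    by (simp add: index_set_def)
  have E1: "E_prod [A] = e_prod A" "E_prod [B] = e_prod B"
    by (simp_all only: E_prod_simps right_unit[OF cA] right_unit[OF cB])
  have *: "O_supercomm N \<epsilon> [[a]] [[a], A, B] \<in> carrier R"
    "emb (O_supercomm N \<epsilon> [[a]] [[a], A, B]) = ?h * (?h * ?br a)" if a: "a \<in> set A" for a
  proof -
    have aI: "a \<in> {1..N}" using a A by auto
    have lists: "\<forall>C\<in>set [[a]]. set C \<subseteq> {1..N}" "\<forall>C\<in>set [[a], A, B]. set C \<subseteq> {1..N}"
      using aI A B by auto
    \<comment> \<open>As a lies in A and A in B, the symmetric difference removes A from B and puts
      a back.\<close>
    have idx: "index_set [[a], A, B] = ?T a" "{a} \<inter> ?T a = {a}"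
      using a AB by (auto simp: index_set_def)
    have e: "e_prod [a] = e a"
      using right_unit[OF clifford_e[OF aI]] by (simp add: e_prod_def)
    have E: "E_prod [[a]] = e a" "E_prod [[a], A, B] = ?G a"
      by (simp_all only: E_prod_simps e right_unit[OF cB] right_unit[OF clifford_e[OF aI]])
    \<comment> \<open>Being positive, |?T a| - 1 does not truncate and has the parity of |?T a| +
      1.\<close>
    have "card (?T a) > 0" by (simp add: card_gt_0_iff)
    then have parity: "alt (card {a} * card (?T a) - card {a}) y = alt (card (?T a) + 1) y" for y :: "('k AC, _) ring_family"
      by (intro alt_cong) simp
    show "O_supercomm N \<epsilon> [[a]] [[a], A, B] \<in> carrier R"
      by (rule O_supercomm_emb(1)[OF lists])
    show "emb (O_supercomm N \<epsilon> [[a]] [[a], A, B]) = ?h * (?h * ?br a)"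
      unfolding O_supercomm_emb(2)[OF lists] index idx E list.set empty_def[symmetric]
      by (simp only: idx parity)
  qed
  have lists: "\<forall>C\<in>set [A]. set C \<subseteq> {1..N}" "\<forall>C\<in>set [B]. set C \<subseteq> {1..N}"
    using A B by auto
  have sum_closed: "(\<Oplus>\<^bsub>R\<^esub>a\<in>set A. O_supercomm N \<epsilon> [[a]] [[a], A, B]) \<in> carrier R"
    by (intro R.finsum_closed Pi_I *)
  show "O_supercomm N \<epsilon> [A] [B] \<in> carrier R"
    by (rule O_supercomm_emb(1)[OF lists])
  show "\<epsilon> \<odot>\<^bsub>R\<^esub> (\<Oplus>\<^bsub>R\<^esub>a\<in>set A. O_supercomm N \<epsilon> [[a]] [[a], A, B]) \<in> carrier R"
    by (intro smult_closed sum_closed)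
  have "emb (O_supercomm N \<epsilon> [A] [B]) = ?h * (?h * (?c * (\<Sum>a\<in>set A. ?br a)))"
    unfolding O_supercomm_emb(2)[OF lists] index E1 Op_bracket_subset[OF cA cB AB e_prod_swap[OF A B]] ..
  also have "\<dots> = ?c * (\<Sum>a\<in>set A. ?h * (?h * ?br a))"
    unfolding sum_distrib_left[symmetric] scalar_left_commute[of "?h" \<epsilon>] ..
  also have "(\<Sum>a\<in>set A. ?h * (?h * ?br a)) = (\<Sum>a\<in>set A. emb (O_supercomm N \<epsilon> [[a]] [[a], A, B]))"
    by (rule sum.cong) (simp_all only: *)
  also have "\<dots> = emb (\<Oplus>\<^bsub>R\<^esub>a\<in>set A. O_supercomm N \<epsilon> [[a]] [[a], A, B])"
    by (intro R.class_hom_finsum[symmetric] emb_hom Pi_I * finite_set)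
  also have "?c * \<dots> = emb (\<epsilon> \<odot>\<^bsub>R\<^esub> (\<Oplus>\<^bsub>R\<^esub>a\<in>set A. O_supercomm N \<epsilon> [[a]] [[a], A, B]))"
    by (rule emb_smult[OF sum_closed, symmetric])
  finally show "emb (O_supercomm N \<epsilon> [A] [B])
    = emb (\<epsilon> \<odot>\<^bsub>R\<^esub> (\<Oplus>\<^bsub>R\<^esub>a\<in>set A. O_supercomm N \<epsilon> [[a]] [[a], A, B]))" .
qed

end

theorem theorem3p15:
  fixes N :: nat and \<epsilon> :: "'k::real_normed_field" and A B :: "nat list"
  assumes "N \<ge> 1"
    and "\<epsilon> = 1 \<or> \<epsilon> = -1"
    and "distinct A" and "set A \<subseteq> {1..N}"
    and "distinct B" and "set B \<subseteq> {1..N}"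
    and "set A \<subseteq> set B"
  shows "O_supercomm N \<epsilon> [A] [B] =
    \<epsilon> \<odot>\<^bsub>AC N \<epsilon>\<^esub> (\<Oplus>\<^bsub>AC N \<epsilon>\<^esub>a\<in>set A. O_supercomm N \<epsilon> [[a]] [[a], A, B])"
  by (rule AC_signed.O_supercomm_subset[OF AC_signed.intro]) (rule assms)+

end
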